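(* Suppose that a linear partial monitoring game (with domain $\mathcal D$ and Legendre potential $F$ satisfying the standing assumptions in the context) has an information ratio of $(\alpha,\beta,\lambda)$ with $\alpha,\beta\ge0$ and $\lambda\ge1$. Then, for any $n\geq 1$ and any finitely supported probability distribution $\mu$ on $\mathcal Z^n$, there exists a policy $\pi$ such that $$\mathfrak{BR}_n(\pi,\mu)\le n(\epsilon_{\mathcal D}+\alpha)+(\beta n)^{1-1/\lambda}\operatorname{diam}(\mathcal D)^{1/\lambda}.$$
   Context: A linear partial monitoring game is given by an action set $\mathcal A\subset\mathbb R^d$, a signal set $\Sigma$, a latent set $\mathcal Z$, a signal function $\Phi:\mathcal A\times\mathcal Z\to\Sigma$, written $\Phi_a(z)$, and a loss function $\ell:\mathcal Z\to[0,1]^d$; $\Phi$ and $\ell$ are known to the learner. A policy $\pi$ maps action/signal sequences to distributions over $\mathcal A$. Given $(z_t)_{t=1}^n\in\mathcal Z^n$, in round $t$ the learner samples $A_t$ from the distribution $P_t$ given by $\pi$ from $(A_s)_{s<t}$, $(\sigma_s)_{s<t}$ and observes $\sigma_t=\Phi_{A_t}(z_t)$. The regret is $\mathfrak R_n(\pi,(z_t))=\max_{a\in\mathcal A}\mathbb E[\sum_{t=1}^n\langle A_t-a,\ell(z_t)\rangle]$ and the Bayesian regret for a finitely supported distribution $\mu$ on $\mathcal Z^n$ is $\mathfrak{BR}_n(\pi,\mu)=\int_{\mathcal Z^n}\mathfrak R_n(\pi,(z_t))\,d\mu((z_t))$. Standing assumptions. $F:\mathbb R^d\to\mathbb R\cup\{\infty\}$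 is Legendre (proper, convex, lower semi-continuous, essentially smooth and essentially strictly convex). $\mathcal D\subset\operatorname{conv}(\mathcal A)$ is compact, convex and has non-empty relative interior. Moreover: (a) $1<|\mathcal A|<\infty$; (b) $\langle a,\ell(z)\rangle\in[0,1]$ for all $a\in\mathcal A$, $z\in\mathcal Z$; (c) $\mathcal D\subset\operatorname{dom}(F)=\{x:F(x)<\infty\}$; (d) $\operatorname{diam}(\mathcal D)=\sup_{x,y\in\mathcal D}(F(x)-F(y))<\infty$. Notation. $\mathcal P$ is the set of probability distributions on $\mathcal A$. $\operatorname{D}(p,q)=F(p)-F(q)-\langle\nabla F(q),p-q\rangle$ is the Bregman divergence; if $F$ is not differentiable at $q$, then $\langle\nabla F(q),p-q\rangle$ is read as the one-sided directional derivative $\lim_{h\to0^+}(F(q+h(p-q))-F(q))/h$. $\mathcal V$ is the set of finitely supported probability distributions on $\mathcal Z\times\mathcal D$. $\epsilon_{\mathcal D}=\max_{a\in\mathcal A}\min_{b\in\mathcal D}\sup_{z\in\mathcal Z}\langle b-a,\ell(z)\rangle$. Information ratio. The game has an information ratio of $(\alpha,\beta,\lambda)$ if for any $\nu\in\mathcal V$ there exists $p\in\mathcal P$ such that when $(Z,A^*,A)$ has law $\nu\otimes p$ (i.e. $(Z,A^* )\sim\nu$ and $A\sim p$ independently), $$\mathbb E[\langle A-A^*,\ell(Z)\rangle]\le\alpha+\beta^{1-1/\lambda}\,\big(\mathbb E[\operatorname{D}(\mathbb E[A^*\mid\Phi_A(Z),A],\mathbb E[A^*])]\big)^{1/\lambda}.$$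 *)

theory Defs
  imports "HOL-Probability.Probability"
begin

section \<open>Legendre functions\<close>

definition edom :: "('v \<Rightarrow> ereal) \<Rightarrow> 'v set" where
  "edom F = {x. F x < \<infinity>}"

definition proper :: "('v \<Rightarrow> ereal) \<Rightarrow> bool" where
  "proper F \<longleftrightarrow> edom F \<noteq> {} \<and> (\<forall>x. F x \<noteq> -\<infinity>)"

definition econvex :: "('v::real_vector \<Rightarrow> ereal) \<Rightarrow> bool" where
  "econvex F \<longleftrightarrow> (\<forall>x y u. 0 < u \<and> u < 1 \<longrightarrow>
     F (u *\<^sub>R x + (1 - u) *\<^sub>R y) \<le> ereal u * F x + ereal (1 - u) * F y)"

definition lower_semicontinuous :: "('v::topological_space \<Rightarrow> ereal) \<Rightarrow> bool" where
  "lower_semicontinuous F \<longleftrightarrow> (\<forall>x. F x \<le> Liminf (at x) F)"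

text \<open>
  Differentiability requires \<open>F\<close> to be finite near the point. This has to be demanded explicitly,
  because \<^const>\<open>real_of_ereal\<close> maps infinite values to \<open>0\<close>.
\<close>

definition ediff_at :: "('v::euclidean_space \<Rightarrow> ereal) \<Rightarrow> 'v \<Rightarrow> bool" where
  "ediff_at F x \<longleftrightarrow>
     x \<in> interior {y. \<bar>F y\<bar> \<noteq> \<infinity>} \<and> (\<lambda>y. real_of_ereal (F y)) differentiable (at x)"

definition gradient :: "('v::euclidean_space \<Rightarrow> ereal) \<Rightarrow> 'v \<Rightarrow> 'v" where
  "gradient F x = (THE g. GDERIV (\<lambda>y. real_of_ereal (F y)) x :> g)"

definition essentially_smooth :: "('v::euclidean_space \<Rightarrow> ereal) \<Rightarrow> bool" where
  "essentially_smooth F \<longleftrightarrow>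
     interior (edom F) \<noteq> {} \<and>
     (\<forall>x \<in> interior (edom F). ediff_at F x) \<and>
     (\<forall>X x. (\<forall>i::nat. X i \<in> interior (edom F)) \<and> X \<longlonglongrightarrow> x \<and>
        x \<in> frontier (interior (edom F)) \<longrightarrow>
        filterlim (\<lambda>i. norm (gradient F (X i))) at_top sequentially)"

definition subdifferential :: "('v::real_inner \<Rightarrow> ereal) \<Rightarrow> 'v \<Rightarrow> 'v set" where
  "subdifferential F x = {g. \<forall>y. F x + ereal (g \<bullet> (y - x)) \<le> F y}"

definition essentially_strictly_convex :: "('v::real_inner \<Rightarrow> ereal) \<Rightarrow> bool" where
  "essentially_strictly_convex F \<longleftrightarrow>
     (\<forall>S. convex S \<and> S \<subseteq> {x. subdifferential F x \<noteq> {}} \<longrightarrow>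
       (\<forall>x\<in>S. \<forall>y\<in>S. \<forall>u. x \<noteq> y \<and> 0 < u \<and> u < 1 \<longrightarrow>
          F (u *\<^sub>R x + (1 - u) *\<^sub>R y) < ereal u * F x + ereal (1 - u) * F y))"

definition legendre :: "('v::euclidean_space \<Rightarrow> ereal) \<Rightarrow> bool" where
  "legendre F \<longleftrightarrow> proper F \<and> econvex F \<and> lower_semicontinuous F \<and>
     essentially_smooth F \<and> essentially_strictly_convex F"

definition directional_deriv :: "('v::real_normed_vector \<Rightarrow> ereal) \<Rightarrow> 'v \<Rightarrow> 'v \<Rightarrow> ereal" where
  "directional_deriv F q v = Lim (at_right 0) (\<lambda>h. (F (q + h *\<^sub>R v) - F q) / ereal h)"

text \<open>
  The directional derivative at a boundary point may be \<open>-\<infinity>\<close>, so the divergence is extended-real.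
\<close>

definition bregman :: "('v::euclidean_space \<Rightarrow> ereal) \<Rightarrow> 'v \<Rightarrow> 'v \<Rightarrow> ereal" where
  "bregman F p q = F p - F q -
     (if ediff_at F q then ereal (gradient F q \<bullet> (p - q)) else directional_deriv F q (p - q))"

definition F_diam :: "('v \<Rightarrow> ereal) \<Rightarrow> 'v set \<Rightarrow> ereal" where
  "F_diam F D = (SUP (x, y) \<in> D \<times> D. F x - F y)"


section \<open>Powers and expectations\<close>

text \<open>
  In the library \<open>0 powr 0 = 0\<close>. Exponents \<open>1 - 1/\<lambda>\<close> vanish for \<open>\<lambda> = 1\<close>, where the intended
  value of the power is \<open>1\<close> even for base \<open>0\<close>.
\<close>

definition rpow :: "real \<Rightarrow> real \<Rightarrow> real" where
  "rpow x s = (if s = 0 then 1 else x powr s)"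

text \<open>Used only for nonnegative bases and positive exponents.\<close>

definition epow :: "ereal \<Rightarrow> real \<Rightarrow> ereal" where
  "epow x s = (if x = \<infinity> then \<infinity> else ereal (real_of_ereal x powr s))"

text \<open>Expectation of an extended-real variable under a finitely supported distribution.\<close>

definition eexpectation :: "'x pmf \<Rightarrow> ('x \<Rightarrow> ereal) \<Rightarrow> ereal" where
  "eexpectation M X = (\<Sum>x\<in>set_pmf M. ereal (pmf M x) * X x)"

text \<open>
  Conditional expectation of \<open>Y\<close> given a random element \<open>X\<close>, as a function of the outcome;
  meaningful at outcomes of positive probability.
\<close>

definition cond_expect ::
  "'x pmf \<Rightarrow> ('x \<Rightarrow> 'y) \<Rightarrow> ('x \<Rightarrow> 'v) \<Rightarrow> 'x \<Rightarrow> 'v::{banach, second_countable_topology}" where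
  "cond_expect M X Y w = measure_pmf.expectation (cond_pmf M {w'. X w' = X w}) Y"


section \<open>Linear partial monitoring\<close>

definition linear_pm_game ::
  "(real^'d) set \<Rightarrow> 's set \<Rightarrow> 'z set \<Rightarrow> (real^'d \<Rightarrow> 'z \<Rightarrow> 's) \<Rightarrow> ('z \<Rightarrow> real^'d) \<Rightarrow> bool" where
  "linear_pm_game A S Z \<Phi> loss \<longleftrightarrow>
     (\<forall>a\<in>A. \<forall>z\<in>Z. \<Phi> a z \<in> S) \<and> (\<forall>z\<in>Z. \<forall>i. 0 \<le> loss z $ i \<and> loss z $ i \<le> 1)"

text \<open>Histories are lists of action/signal pairs, oldest first.\<close>

type_synonym ('a, 's) policy = "('a \<times> 's) list \<Rightarrow> 'a pmf"

definition is_policy :: "'a set \<Rightarrow> 's set \<Rightarrow> ('a, 's) policy \<Rightarrow> bool" where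
  "is_policy A S \<pi> \<longleftrightarrow> (\<forall>h. set h \<subseteq> A \<times> S \<longrightarrow> set_pmf (\<pi> h) \<subseteq> A)"

text \<open>Law of the history after \<open>t\<close> rounds; round \<open>t + 1\<close> uses the latent \<open>zs ! t\<close>.\<close>

primrec history_pmf ::
  "('a \<Rightarrow> 'z \<Rightarrow> 's) \<Rightarrow> ('a, 's) policy \<Rightarrow> 'z list \<Rightarrow> nat \<Rightarrow> ('a \<times> 's) list pmf" where
  "history_pmf \<Phi> \<pi> zs 0 = return_pmf []"
| "history_pmf \<Phi> \<pi> zs (Suc t) =
     bind_pmf (history_pmf \<Phi> \<pi> zs t) (\<lambda>h. map_pmf (\<lambda>a. h @ [(a, \<Phi> a (zs ! t))]) (\<pi> h))"

definition regret ::
  "(real^'d) set \<Rightarrow> (real^'d \<Rightarrow> 'z \<Rightarrow> 's) \<Rightarrow> ('z \<Rightarrow> real^'d) \<Rightarrow> (real^'d, 's) policy \<Rightarrow> 'z list \<Rightarrow> real"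
where
  "regret A \<Phi> loss \<pi> zs =
     (MAX a\<in>A. measure_pmf.expectation (history_pmf \<Phi> \<pi> zs (length zs))
        (\<lambda>h. \<Sum>t<length zs. (fst (h ! t) - a) \<bullet> loss (zs ! t)))"

definition bayesian_regret ::
  "(real^'d) set \<Rightarrow> (real^'d \<Rightarrow> 'z \<Rightarrow> 's) \<Rightarrow> ('z \<Rightarrow> real^'d) \<Rightarrow> (real^'d, 's) policy \<Rightarrow>
   'z list pmf \<Rightarrow> real" where
  "bayesian_regret A \<Phi> loss \<pi> \<mu> = measure_pmf.expectation \<mu> (regret A \<Phi> loss \<pi>)"

text \<open>
  For nonempty \<open>Z\<close> and compact nonempty \<open>D\<close> the infimum is attained, since
  \<open>b \<mapsto> sup\<^sub>z \<langle>b - a, loss z\<rangle>\<close> is Lipschitz for bounded losses.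
\<close>

definition approx_err :: "(real^'d) set \<Rightarrow> 'z set \<Rightarrow> (real^'d) set \<Rightarrow> ('z \<Rightarrow> real^'d) \<Rightarrow> real" where
  "approx_err A Z D loss = (MAX a\<in>A. INF b\<in>D. SUP z\<in>Z. (b - a) \<bullet> loss z)"

text \<open>Outcomes of \<open>\<nu> \<otimes> p\<close> have the form \<open>((z, b), a)\<close>, with \<open>b\<close> the value of \<open>A\<^sup>*\<close>.\<close>

definition has_information_ratio ::
  "(real^'d) set \<Rightarrow> 'z set \<Rightarrow> (real^'d) set \<Rightarrow> (real^'d \<Rightarrow> 'z \<Rightarrow> 's) \<Rightarrow> ('z \<Rightarrow> real^'d) \<Rightarrow>
   (real^'d \<Rightarrow> ereal) \<Rightarrow> real \<Rightarrow> real \<Rightarrow> real \<Rightarrow> bool" where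
  "has_information_ratio A Z D \<Phi> loss F \<alpha> \<beta> lam \<longleftrightarrow>
     (\<forall>\<nu> :: ('z \<times> (real^'d)) pmf. finite (set_pmf \<nu>) \<and> set_pmf \<nu> \<subseteq> Z \<times> D \<longrightarrow>
       (\<exists>p. set_pmf p \<subseteq> A \<and>
         ereal (measure_pmf.expectation (pair_pmf \<nu> p) (\<lambda>((z, b), a). (a - b) \<bullet> loss z)) \<le>
         ereal \<alpha> + ereal (rpow \<beta> (1 - 1 / lam)) *
           epow (eexpectation (pair_pmf \<nu> p)
             (\<lambda>w. bregman F
                (cond_expect (pair_pmf \<nu> p) (\<lambda>((z, b), a). (\<Phi> a z, a)) (\<lambda>((z, b), a). b) w)
                (measure_pmf.expectation (pair_pmf \<nu> p) (\<lambda>((z, b), a). b))))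
             (1 / lam)))"

end

theory Submission
  imports Defs
begin

text \<open>
  Let \<open>A\<^sup>*\<close> be a point of \<open>D\<close> approximating the best action in hindsight, as a function of the
  latents \<open>zs \<sim> \<mu>\<close>. After each history the learner plays the distribution provided by the
  information ratio for the posterior law of the current latent together with \<open>A\<^sup>*\<close>. The posterior
  mean of \<open>A\<^sup>*\<close> is a martingale in \<open>D\<close>, so by Jensen the expected one-step Bregman divergences are
  at most the expected increments of \<open>F\<close> along it, whose sum telescopes and is at most the diameter.
  Bounding the concave power \<open>w\<^sup>1\<^sup>/\<^sup>\<lambda>\<close> by its tangent at a point \<open>m\<close> makes the per-round bounds linear,
  hence summable; optimising over \<open>m\<close> at the end replaces Hoelder's inequality.
\<close>

subsection \<open>Finitely supported expectations\<close>

lemma expectation_finite_pmf: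
  fixes f :: "'x \<Rightarrow> 'v::{banach, second_countable_topology}"
  assumes "finite (set_pmf M)"
  shows "measure_pmf.expectation M f = (\<Sum>x\<in>set_pmf M. pmf M x *\<^sub>R f x)"
  using assms by (rule integral_measure_pmf)

lemma expectation_bind_finite_pmf:
  fixes f :: "'y \<Rightarrow> 'v::{banach, second_countable_topology}"
  assumes "finite (set_pmf M)" "\<And>x. x \<in> set_pmf M \<Longrightarrow> finite (set_pmf (K x))"
  shows "measure_pmf.expectation (bind_pmf M K) f =
    measure_pmf.expectation M (\<lambda>x. measure_pmf.expectation (K x) f)"
  by (simp only: pmf_expectation_bind[OF assms subset_refl] expectation_finite_pmf[OF assms(1)])

lemma expectation_cong_pmf:
  fixes f :: "'x \<Rightarrow> 'v::{banach, second_countable_topology}"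
  assumes "\<And>x. x \<in> set_pmf M \<Longrightarrow> f x = g x"
  shows "measure_pmf.expectation M f = measure_pmf.expectation M g"
  using assms by (intro integral_cong_AE) (auto simp: AE_measure_pmf_iff)

lemma expectation_mono_finite_pmf:
  fixes f :: "'x \<Rightarrow> real"
  assumes "finite (set_pmf M)" "\<And>x. x \<in> set_pmf M \<Longrightarrow> f x \<le> g x"
  shows "measure_pmf.expectation M f \<le> measure_pmf.expectation M g"
  using assms by (simp add: expectation_finite_pmf sum_mono mult_left_mono)

lemma sum_pmf_set_pmf: "finite (set_pmf M) \<Longrightarrow> (\<Sum>x\<in>set_pmf M. pmf M x) = 1"
  by (rule sum_pmf_eq_1) auto

lemma expectation_in_convex:
  fixes X :: "'x \<Rightarrow> 'v::{banach, second_countable_topology}"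
  assumes "finite (set_pmf M)" "convex C" "\<And>x. x \<in> set_pmf M \<Longrightarrow> X x \<in> C"
  shows "measure_pmf.expectation M X \<in> C"
  using assms by (auto simp: expectation_finite_pmf sum_pmf_set_pmf intro!: convex_sum)

lemma Jensen_finite_pmf:
  fixes X :: "'x \<Rightarrow> 'v::{banach, second_countable_topology}"
  assumes "finite (set_pmf M)" "convex_on C f" "\<And>x. x \<in> set_pmf M \<Longrightarrow> X x \<in> C"
  shows "f (measure_pmf.expectation M X) \<le> measure_pmf.expectation M (\<lambda>x. f (X x))"
  using convex_on_sum[of "set_pmf M" C f "pmf M" X] assms
  by (simp add: expectation_finite_pmf sum_pmf_set_pmf set_pmf_not_empty)

subsection \<open>Expected Bregman divergence from the mean\<close>

lemma ereal_real_of_edom: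
  assumes "proper F" "x \<in> edom F"
  shows "F x = ereal (real_of_ereal (F x))"
  using assms by (cases "F x") (auto simp: proper_def edom_def)

lemma convex_on_real_of_ereal:
  assumes F: "proper F" "econvex F" and C: "convex C" "C \<subseteq> edom F"
  shows "convex_on C (\<lambda>x. real_of_ereal (F x))"
proof (rule convex_onI)
  fix t :: real and x y assume t: "0 < t" "t < 1" and xy: "x \<in> C" "y \<in> C"
  define z where "z = (1 - t) *\<^sub>R x + t *\<^sub>R y"
  have "z \<in> C" using C(1) xy t unfolding z_def by (intro convexD) auto
  then have *: "F x = ereal (real_of_ereal (F x))" "F y = ereal (real_of_ereal (F y))"
    "F z = ereal (real_of_ereal (F z))"
    using ereal_real_of_edom[OF F(1)] C(2) xy by blast+
  have "F z \<le> ereal (1 - t) * F x + ereal t * F y"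
    using F(2)[unfolded econvex_def, rule_format, of "1 - t" x y] t by (simp add: z_def)
  then show "real_of_ereal (F z) \<le> (1 - t) * real_of_ereal (F x) + t * real_of_ereal (F y)"
    by (subst (asm) *(1), subst (asm) *(2), subst (asm) *(3)) simp
qed (rule C)

text \<open>The point at parameter \<open>h\<close> divides the segment from \<open>q\<close> to the
  point at parameter \<open>k\<close> in the proportion \<open>h / k\<close>, so one use of
  convexity compares the two slopes.\<close>

lemma convex_on_difference_quotient_mono:
  assumes f: "convex_on C f" and C: "q \<in> C" "p \<in> C" and h: "0 < h" "h \<le> k" "k \<le> (1::real)"
  shows "(f (q + h *\<^sub>R (p - q)) - f q) / h \<le> (f (q + k *\<^sub>R (p - q)) - f q) / k"
proof -
  define r where "r = q + k *\<^sub>R (p - q)"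
  have "r = (1 - k) *\<^sub>R q + k *\<^sub>R p" by (simp add: r_def algebra_simps)
  then have "r \<in> C"
    using convexD[OF convex_on_imp_convex[OF f] C, of "1 - k" k] h by simp
  moreover have "(1 - h / k) *\<^sub>R q + (h / k) *\<^sub>R r = q + h *\<^sub>R (p - q)"
    using h by (simp add: r_def algebra_simps)
  ultimately have "f (q + h *\<^sub>R (p - q)) \<le> (1 - h / k) * f q + (h / k) * f r"
    using convex_onD[OF f, of "h / k" q r] C h by simp
  then have "f (q + h *\<^sub>R (p - q)) - f q \<le> (h / k) * (f r - f q)"
    by (simp add: algebra_simps)
  then show ?thesis
    using h by (simp add: r_def divide_simps mult.commute)
qed

text \<open>Slopes of a convex function decrease as \<open>h\<close> decreases to \<open>0\<close>,
  so their limit is the infimum over \<open>{0<..1}\<close>. The bound \<open>B\<close> excludes the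
  value \<open>-\<infinity>\<close>, and \<open>h = 1\<close> gives the upper estimate on
  \<open>d\<close>.\<close>

lemma directional_deriv_bounded_below:
  fixes F :: "'v::euclidean_space \<Rightarrow> ereal"
  defines "f \<equiv> \<lambda>x. real_of_ereal (F x)"
  assumes F: "proper F" "econvex F" and C: "convex C" "C \<subseteq> edom F" "q \<in> C" "p \<in> C"
    and B: "\<And>h. 0 < h \<Longrightarrow> h \<le> 1 \<Longrightarrow> B \<le> (f (q + h *\<^sub>R (p - q)) - f q) / h"
  obtains d where "directional_deriv F q (p - q) = ereal d" "d \<le> f p - f q"
    "((\<lambda>h. (f (q + h *\<^sub>R (p - q)) - f q) / h) \<longlongrightarrow> d) (at_right 0)"
proof -
  define \<phi> where "\<phi> h = (f (q + h *\<^sub>R (p - q)) - f q) / h" for h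
  have cf: "convex_on C f" unfolding f_def by (rule convex_on_real_of_ereal[OF F C(1,2)])
  define d where "d = (INF h\<in>{0<..1}. \<phi> h)"
  have bdd: "bdd_below (\<phi> ` {0<..1})"
    using B by (auto simp: \<phi>_def intro!: bdd_belowI2[where m = B])
  have dle: "d \<le> \<phi> h" if "0 < h" "h \<le> 1" for h
    unfolding d_def by (rule cINF_lower[OF bdd]) (use that in auto)
  have unit: "\<forall>\<^sub>F h in at_right (0::real). 0 < h \<and> h \<le> 1"
    using eventually_at_right_real[of 0 1] by (rule eventually_mono) auto
  have lim: "(\<phi> \<longlongrightarrow> d) (at_right 0)"
  proof (rule order_tendstoI)
    fix a assume "a < d"
    then show "\<forall>\<^sub>F h in at_right 0. a < \<phi> h"
      using dle by (intro eventually_mono[OF unit]) force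
  next
    fix a assume "d < a"
    \<comment> \<open>A parameter whose slope is already below \<open>a\<close>; monotonicity keeps
      all smaller parameters below \<open>a\<close> too.\<close>
    then obtain k where k: "k \<in> {0<..1}" "\<phi> k < a"
      unfolding d_def using cINF_less_iff[OF _ bdd, of a] by auto
    then have "\<forall>\<^sub>F h in at_right 0. h \<in> {0<..<k}"
      by (intro eventually_at_right_real) auto
    then show "\<forall>\<^sub>F h in at_right 0. \<phi> h < a"
    proof (rule eventually_mono)
      fix h assume "h \<in> {0<..<k}"
      then have "\<phi> h \<le> \<phi> k"
        unfolding \<phi>_def using k convex_on_difference_quotient_mono[OF cf C(3,4), of h k] by auto
      with k show "\<phi> h < a" by simp
    qed
  qed
  have "\<forall>\<^sub>F h in at_right 0. (F (q + h *\<^sub>R (p - q)) - F q) / ereal h = ereal (\<phi> h)"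
    using unit
  proof (rule eventually_mono)
    fix h :: real assume h: "0 < h \<and> h \<le> 1"
    have "q + h *\<^sub>R (p - q) = (1 - h) *\<^sub>R q + h *\<^sub>R p" by (simp add: algebra_simps)
    then have "q + h *\<^sub>R (p - q) \<in> edom F"
      using convexD[OF C(1,3,4), of "1 - h" h] h C(2) by auto
    then have "F (q + h *\<^sub>R (p - q)) = ereal (f (q + h *\<^sub>R (p - q)))" "F q = ereal (f q)"
      using ereal_real_of_edom[OF F(1)] C unfolding f_def by blast+
    then show "(F (q + h *\<^sub>R (p - q)) - F q) / ereal h = ereal (\<phi> h)"
      using h by (simp add: \<phi>_def)
  qed
  then have "((\<lambda>h. (F (q + h *\<^sub>R (p - q)) - F q) / ereal h) \<longlongrightarrow> ereal d) (at_right 0)"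
    using lim by (subst tendsto_cong) (auto intro: tendsto_ereal)
  then have "directional_deriv F q (p - q) = ereal d"
    unfolding directional_deriv_def by (intro tendsto_Lim) auto
  moreover have "d \<le> f p - f q" using dle[of 1] by (simp add: \<phi>_def)
  ultimately show ?thesis using lim that unfolding \<phi>_def by blast
qed

text \<open>
  Where \<open>F\<close> is not differentiable at the mean \<open>q\<close>, finiteness of the directional derivatives comes
  from \<open>q\<close> being a convex combination of the values of \<open>X\<close> with positive weights: the weighted
  difference quotients sum to a nonnegative number, so each one is bounded below by the others.
\<close>

lemma eexpectation_bregman_mean:
  fixes F :: "'v::euclidean_space \<Rightarrow> ereal" and X :: "'x \<Rightarrow> 'v"
  defines "f \<equiv> \<lambda>x. real_of_ereal (F x)"
  assumes F: "proper F" "econvex F" and C: "convex C" "C \<subseteq> edom F"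
    and M: "finite (set_pmf M)" and X: "\<And>x. x \<in> set_pmf M \<Longrightarrow> X x \<in> C"
    and q: "q = measure_pmf.expectation M X"
  obtains w where "eexpectation M (\<lambda>x. bregman F (X x) q) = ereal w" "0 \<le> w"
    "w \<le> measure_pmf.expectation M (\<lambda>x. f (X x)) - f q"
proof -
  define S where "S = set_pmf M"
  have S: "finite S" "\<And>x. x \<in> S \<Longrightarrow> 0 < pmf M x" "sum (pmf M) S = 1"
    using M sum_pmf_set_pmf[OF M] by (auto simp: S_def pmf_positive)
  have cf: "convex_on C f" unfolding f_def by (rule convex_on_real_of_ereal[OF F C])
  have qC: "q \<in> C" unfolding q by (rule expectation_in_convex[OF M C(1) X])
  have Ff: "F y = ereal (f y)" if "y \<in> C" for y
    unfolding f_def using ereal_real_of_edom[OF F(1)] that C by blast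
  have XC: "X x \<in> C" if "x \<in> S" for x using X that S_def by simp
  have qS: "q = (\<Sum>x\<in>S. pmf M x *\<^sub>R X x)"
    unfolding q S_def by (rule expectation_finite_pmf[OF M])
  have ES: "measure_pmf.expectation M g = (\<Sum>x\<in>S. pmf M x * g x)" for g :: "'x \<Rightarrow> real"
    by (simp add: expectation_finite_pmf[OF M] S_def)
  have centred: "(\<Sum>x\<in>S. pmf M x *\<^sub>R (X x - q)) = 0"
    using S(3) by (simp add: scaleR_diff_right sum_subtractf qS[symmetric] flip: scaleR_sum_left)
  \<comment> \<open>\<open>d x\<close> stands for the derivative of \<open>F\<close> at
    \<open>q\<close> towards \<open>X x\<close>, in either reading of the divergence. The first
    inequality will give the upper bound on \<open>w\<close>, the second its nonnegativity.\<close>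
  have "\<exists>d. (\<forall>x\<in>S. bregman F (X x) q = ereal (f (X x) - f q - d x)) \<and>
    (\<Sum>x\<in>S. pmf M x * d x) \<ge> 0 \<and> (\<Sum>x\<in>S. pmf M x * (f (X x) - f q - d x)) \<ge> 0"
  proof (cases "ediff_at F q")
    case True
    define d where "d x = gradient F q \<bullet> (X x - q)" for x
    have "(\<Sum>x\<in>S. pmf M x * d x) = gradient F q \<bullet> (\<Sum>x\<in>S. pmf M x *\<^sub>R (X x - q))"
      by (simp add: d_def inner_sum_right)
    then have "(\<Sum>x\<in>S. pmf M x * d x) = 0" by (simp add: centred)
    moreover have "f q \<le> (\<Sum>x\<in>S. pmf M x * f (X x))"
      using Jensen_finite_pmf[OF M cf, of X] X by (simp add: q[symmetric] ES)
    ultimately have "(\<Sum>x\<in>S. pmf M x * (f (X x) - f q - d x)) \<ge> 0"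
      using S(3) by (simp add: right_diff_distrib sum_subtractf flip: sum_distrib_right)
    moreover have "bregman F (X x) q = ereal (f (X x) - f q - d x)" if "x \<in> S" for x
      using True by (simp add: bregman_def Ff XC qC that d_def)
    ultimately show ?thesis using \<open>(\<Sum>x\<in>S. pmf M x * d x) = 0\<close> by (intro exI[of _ d]) auto
  next
    case False
    define \<phi> where "\<phi> x h = (f (q + h *\<^sub>R (X x - q)) - f q) / h" for x and h :: real
    \<comment> \<open>Moving every value of \<open>X\<close> towards \<open>q\<close> by the same
      factor \<open>h\<close> leaves the mean at \<open>q\<close>, so Jensen applies to the
      contracted variable.\<close>
    have sum_ge: "(\<Sum>x\<in>S. pmf M x * \<phi> x h) \<ge> 0" if h: "0 < h" "h \<le> 1" for h
    proof -
      have in_C: "q + h *\<^sub>R (X x - q) \<in> C" if "x \<in> S" for x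
      proof -
        have "q + h *\<^sub>R (X x - q) = (1 - h) *\<^sub>R q + h *\<^sub>R X x" by (simp add: algebra_simps)
        then show ?thesis using convexD[OF C(1) qC XC[OF that], of "1 - h" h] h by simp
      qed
      have "(\<Sum>x\<in>S. pmf M x *\<^sub>R (q + h *\<^sub>R (X x - q))) =
        (\<Sum>x\<in>S. pmf M x) *\<^sub>R q + h *\<^sub>R (\<Sum>x\<in>S. pmf M x *\<^sub>R (X x - q))"
        by (simp add: scaleR_add_right sum.distrib scaleR_sum_left scaleR_sum_right mult.commute)
      then have "(\<Sum>x\<in>S. pmf M x *\<^sub>R (q + h *\<^sub>R (X x - q))) = q"
        using S(3) centred by simp
      then have "f q \<le> measure_pmf.expectation M (\<lambda>x. f (q + h *\<^sub>R (X x - q)))"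
        using Jensen_finite_pmf[OF M cf, of "\<lambda>x. q + h *\<^sub>R (X x - q)"] in_C
        by (simp add: expectation_finite_pmf[OF M] S_def)
      then have "0 \<le> (\<Sum>x\<in>S. pmf M x * (f (q + h *\<^sub>R (X x - q)) - f q)) / h"
        using S(3) h by (simp add: ES right_diff_distrib sum_subtractf flip: sum_distrib_right)
      then show ?thesis by (simp add: \<phi>_def sum_divide_distrib)
    qed
    have "\<exists>d. directional_deriv F q (X x - q) = ereal d \<and> d \<le> f (X x) - f q \<and>
      (\<phi> x \<longlongrightarrow> d) (at_right 0)" if x: "x \<in> S" for x
    proof -
      \<comment> \<open>This is \<open>sum_ge\<close> solved for the slope at \<open>x\<close>,
        after each other slope has been replaced by its largest value, the one at
        \<open>h = 1\<close>. The weight of \<open>x\<close> is positive, so the division is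
        legitimate.\<close>
      define B where "B = - (\<Sum>y\<in>S - {x}. pmf M y * (f (X y) - f q)) / pmf M x"
      have "B \<le> \<phi> x h" if h: "0 < h" "h \<le> 1" for h
      proof -
        have "\<phi> y h \<le> f (X y) - f q" if "y \<in> S" for y
          using convex_on_difference_quotient_mono[OF cf qC XC[OF that], of h 1] h
          by (simp add: \<phi>_def)
        then have "(\<Sum>y\<in>S - {x}. pmf M y * \<phi> y h) \<le> (\<Sum>y\<in>S - {x}. pmf M y * (f (X y) - f q))"
          by (intro sum_mono mult_left_mono) auto
        moreover have "0 \<le> pmf M x * \<phi> x h + (\<Sum>y\<in>S - {x}. pmf M y * \<phi> y h)"
          using sum_ge[OF h] sum.remove[OF S(1) x, of "\<lambda>y. pmf M y * \<phi> y h"] by simp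
        ultimately have "- (\<Sum>y\<in>S - {x}. pmf M y * (f (X y) - f q)) \<le> pmf M x * \<phi> x h" by linarith
        then show ?thesis
          unfolding B_def using S(2)[OF x] by (subst pos_divide_le_eq) (simp_all add: mult.commute)
      qed
      then show ?thesis
        using directional_deriv_bounded_below[OF F C qC XC[OF x], of B]
        unfolding \<phi>_def f_def by blast
    qed
    then obtain d where d: "\<And>x. x \<in> S \<Longrightarrow> directional_deriv F q (X x - q) = ereal (d x)"
      "\<And>x. x \<in> S \<Longrightarrow> d x \<le> f (X x) - f q" "\<And>x. x \<in> S \<Longrightarrow> (\<phi> x \<longlongrightarrow> d x) (at_right 0)"
      by metis
    have "((\<lambda>h. \<Sum>x\<in>S. pmf M x * \<phi> x h) \<longlongrightarrow> (\<Sum>x\<in>S. pmf M x * d x)) (at_right 0)"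
      by (intro tendsto_intros d(3))
    moreover have "\<forall>\<^sub>F h in at_right (0::real). 0 \<le> (\<Sum>x\<in>S. pmf M x * \<phi> x h)"
      using eventually_at_right_real[of 0 1] by (rule eventually_mono) (auto intro: sum_ge)
    ultimately have "0 \<le> (\<Sum>x\<in>S. pmf M x * d x)"
      by (intro tendsto_lowerbound[of _ _ "at_right (0::real)"]) auto
    moreover have "0 \<le> (\<Sum>x\<in>S. pmf M x * (f (X x) - f q - d x))"
      using d(2) by (intro sum_nonneg mult_nonneg_nonneg) auto
    moreover have "bregman F (X x) q = ereal (f (X x) - f q - d x)" if "x \<in> S" for x
      using False by (simp add: bregman_def Ff XC qC that d(1))
    ultimately show ?thesis by blast
  qed
  then obtain d where d: "\<And>x. x \<in> S \<Longrightarrow> bregman F (X x) q = ereal (f (X x) - f q - d x)"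
    "(\<Sum>x\<in>S. pmf M x * d x) \<ge> 0" "(\<Sum>x\<in>S. pmf M x * (f (X x) - f q - d x)) \<ge> 0"
    by blast
  define w where "w = (\<Sum>x\<in>S. pmf M x * (f (X x) - f q - d x))"
  have "eexpectation M (\<lambda>x. bregman F (X x) q) = ereal w"
    unfolding eexpectation_def w_def by (simp add: d(1) flip: S_def)
  moreover have "w \<le> measure_pmf.expectation M (\<lambda>x. f (X x)) - f q"
    using d(2) S(3) unfolding w_def ES
    by (simp add: right_diff_distrib sum_subtractf flip: sum_distrib_right)
  ultimately show ?thesis using that d(3) w_def by blast
qed

text \<open>Total probability in sampling form: an outcome redrawn within its own fibre of
  \<open>X\<close> keeps its law. The tower property and the disintegration over histories both rest
  on it.\<close>

lemma bind_cond_pmf_fibre: "bind_pmf M (\<lambda>w. cond_pmf M {w'. X w' = X w}) = M"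
proof (rule bind_cond_pmf_cancel[of M M "\<lambda>w w'. X w' = X w"])
  fix w w' assume "X w' = X w"
  then have "{v. X v = X w} = {v. X w' = X v}" by auto
  then show "measure_pmf.prob M {v. X v = X w} = measure_pmf.prob M {v. X w' = X v}" by simp
qed blast+

lemma expectation_cond_expect:
  fixes Y :: "'x \<Rightarrow> 'v::{banach, second_countable_topology}"
  assumes "finite (set_pmf M)"
  shows "measure_pmf.expectation M (cond_expect M X Y) = measure_pmf.expectation M Y"
proof -
  have ne: "set_pmf M \<inter> {w'. X w' = X w} \<noteq> {}" if "w \<in> set_pmf M" for w using that by blast
  have "measure_pmf.expectation M Y =
      measure_pmf.expectation (bind_pmf M (\<lambda>w. cond_pmf M {w'. X w' = X w})) Y"
    by (simp only: bind_cond_pmf_fibre)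
  also have "\<dots> = measure_pmf.expectation M (cond_expect M X Y)"
    unfolding cond_expect_def using assms ne
    by (subst expectation_bind_finite_pmf) (auto simp: set_cond_pmf)
  finally show ?thesis ..
qed

lemma cond_expect_in_convex:
  fixes Y :: "'x \<Rightarrow> 'v::{banach, second_countable_topology}"
  assumes "finite (set_pmf M)" "convex C" "\<And>x. x \<in> set_pmf M \<Longrightarrow> Y x \<in> C" "w \<in> set_pmf M"
  shows "cond_expect M X Y w \<in> C"
proof -
  have "set_pmf M \<inter> {w'. X w' = X w} \<noteq> {}" using assms(4) by blast
  then have "set_pmf (cond_pmf M {w'. X w' = X w}) = set_pmf M \<inter> {w'. X w' = X w}"
    by (rule set_cond_pmf)
  then show ?thesis
    unfolding cond_expect_def using assms by (intro expectation_in_convex) auto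
qed

text \<open>Weighted AM-GM for \<open>w\<close> and \<open>m\<close>, multiplied by
  \<open>m powr (s - 1)\<close>; the right-hand side is the tangent at \<open>m\<close> to the power
  function.\<close>

lemma powr_le_tangent:
  fixes s m w :: real
  assumes "0 < s" "s \<le> 1" "0 < m" "0 \<le> w"
  shows "w powr s \<le> m powr (s - 1) * (s * w + (1 - s) * m)"
proof (cases "w = 0")
  case False
  have "w powr s * m powr (1 - s) \<le> s * w + (1 - s) * m"
    by (rule Youngs_inequality_0) (use False assms in auto)
  moreover have "m powr (s - 1) * m powr (1 - s) = 1"
    using assms by (simp flip: powr_add)
  then have "w powr s = m powr (s - 1) * (w powr s * m powr (1 - s))"
    by (simp add: mult.left_commute)
  ultimately show ?thesis
    by (metis mult_left_mono powr_ge_zero)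
qed (use assms in auto)

section \<open>Products and iterated conditioning\<close>

lemma pmf_bind_Pair:
  "pmf (bind_pmf M (\<lambda>x. map_pmf (Pair x) (K x))) (x, y) = pmf M x * pmf (K x) y"
proof -
  have "pmf (map_pmf (Pair x') (K x')) (x, y) = indicator {x} x' * pmf (K x) y" for x'
  proof (cases "x' = x")
    case True
    then show ?thesis by (simp add: pmf_map_inj' inj_on_def)
  next
    case False
    then have "(x, y) \<notin> set_pmf (map_pmf (Pair x') (K x'))" by auto
    then show ?thesis using False by (simp add: pmf_eq_0_set_pmf)
  qed
  then show ?thesis by (simp add: pmf_bind measure_pmf_single)
qed

lemma expectation_pair_finite_pmf:
  fixes f :: "'x \<times> 'y \<Rightarrow> 'v::{banach, second_countable_topology}"
  assumes "finite (set_pmf M)" "finite (set_pmf N)"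
  shows "measure_pmf.expectation (pair_pmf M N) f =
    measure_pmf.expectation M (\<lambda>x. measure_pmf.expectation N (\<lambda>y. f (x, y)))"
  using assms by (simp add: pair_pmf_def expectation_bind_finite_pmf)

text \<open>Used to add one observation to a posterior: conditioning round after round amounts to
  conditioning once on all observations.\<close>

lemma cond_cond_pmf:
  assumes "set_pmf p \<inter> (S \<inter> T) \<noteq> {}"
  shows "cond_pmf (cond_pmf p S) T = cond_pmf p (S \<inter> T)"
proof (rule pmf_eqI)
  fix x
  have S: "set_pmf p \<inter> S \<noteq> {}" using assms by blast
  then have T: "set_pmf (cond_pmf p S) \<inter> T \<noteq> {}" using assms by (auto simp: set_cond_pmf)
  have pos: "measure_pmf.prob p S \<noteq> 0" "measure_pmf.prob p (S \<inter> T) \<noteq> 0"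
    using S assms by (auto simp: measure_pmf_zero_iff)
  have "measure_pmf.prob (cond_pmf p S) T = measure_pmf.prob p (S \<inter> T) / measure_pmf.prob p S"
    using pos(1) unfolding cond_pmf.rep_eq[OF S]
    by (intro measure_uniform_measure) (auto simp: measure_pmf.emeasure_eq_measure)
  then show "pmf (cond_pmf (cond_pmf p S) T) x = pmf (cond_pmf p (S \<inter> T)) x"
    using pos by (simp add: pmf_cond[OF S] pmf_cond[OF T] pmf_cond[OF assms])
qed

text \<open>By independence the mass of \<open>a\<close> cancels, so fixing the action leaves the
  first coordinate conditioned on \<open>V\<close> alone. This evaluates conditional expectations
  given signal and action.\<close>

lemma cond_pair_pmf_Times_singleton:
  fixes M :: "'x pmf" and N :: "'y pmf"
  assumes ne: "set_pmf M \<inter> V \<noteq> {}" and a: "a \<in> set_pmf N"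
  shows "cond_pmf (pair_pmf M N) (V \<times> {a}) = map_pmf (\<lambda>x. (x, a)) (cond_pmf M V)"
proof (rule pmf_eqI)
  fix w :: "'x \<times> 'y"
  obtain x b where w: "w = (x, b)" by force
  have ne': "set_pmf (pair_pmf M N) \<inter> (V \<times> {a}) \<noteq> {}" using assms by auto
  \<comment> \<open>Cutting \<open>V\<close> down to the support makes it countable, as the product
    formula requires, and leaves the mass unchanged.\<close>
  have "measure_pmf.prob (pair_pmf M N) (V \<times> {a}) =
      measure_pmf.prob (pair_pmf M N) ((V \<inter> set_pmf M) \<times> {a})"
    by (rule measure_pmf.finite_measure_eq_AE) (auto simp: AE_measure_pmf_iff)
  also have "\<dots> = measure_pmf.prob M (V \<inter> set_pmf M) * pmf N a"
    by (subst measure_pmf_prob_product) (auto simp: measure_pmf_single countable_Int2)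
  also have "measure_pmf.prob M (V \<inter> set_pmf M) = measure_pmf.prob M V"
    by (rule measure_pmf.finite_measure_eq_AE) (auto simp: AE_measure_pmf_iff)
  finally have m: "measure_pmf.prob (pair_pmf M N) (V \<times> {a}) = measure_pmf.prob M V * pmf N a" .
  show "pmf (cond_pmf (pair_pmf M N) (V \<times> {a})) w = pmf (map_pmf (\<lambda>x. (x, a)) (cond_pmf M V)) w"
  proof (cases "b = a")
    case True
    have "pmf (map_pmf (\<lambda>x. (x, a)) (cond_pmf M V)) (x, a) = pmf (cond_pmf M V) x"
      by (rule pmf_map_inj') (auto simp: inj_on_def)
    then show ?thesis
      using True w a by (simp add: pmf_cond[OF ne'] pmf_cond[OF ne] m pmf_pair pmf_eq_0_set_pmf)
  next
    case False
    then have "w \<notin> set_pmf (map_pmf (\<lambda>x. (x, a)) (cond_pmf M V))" using w by auto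
    then show ?thesis using False w by (simp add: pmf_cond[OF ne'] pmf_eq_0_set_pmf)
  qed
qed

subsection \<open>Posterior of the latents\<close>

text \<open>The actions count as given, so this is an event about the latents alone, without
  reference to a policy. Entry \<open>i\<close> of the history pairs with latent \<open>i\<close>,
  both counted from \<open>0\<close>.\<close>

definition compatible :: "('a \<Rightarrow> 'z \<Rightarrow> 's) \<Rightarrow> ('a \<times> 's) list \<Rightarrow> 'z list set" where
  "compatible \<Phi> h = {zs. \<forall>i<length h. \<Phi> (fst (h ! i)) (zs ! i) = snd (h ! i)}"

lemma compatible_Nil [simp]: "compatible \<Phi> [] = UNIV"
  by (simp add: compatible_def)

lemma compatible_snoc:
  "compatible \<Phi> (h @ [(a, \<sigma>)]) = compatible \<Phi> h \<inter> {zs. \<Phi> a (zs ! length h) = \<sigma>}"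
  by (auto simp: compatible_def less_Suc_eq nth_append)

text \<open>
  The probability of a history depends on the latents only through compatibility, so Bayes' rule
  reduces the posterior to plain conditioning, whatever the policy.
\<close>

lemma pmf_history_pmf:
  "pmf (history_pmf \<Phi> \<pi> zs t) h =
    (if length h = t \<and> zs \<in> compatible \<Phi> h
     then \<Prod>i<t. pmf (\<pi> (take i h)) (fst (h ! i)) else 0)"
proof (induction t arbitrary: h)
  case 0
  then show ?case by (auto simp: pmf_return indicator_def)
next
  case (Suc t)
  define P where "P = history_pmf \<Phi> \<pi> zs t"
  \<comment> \<open>\<open>g\<close> appends a round; being injective, it lets the mass of an
    extended history be read off from its prefix and last action.\<close>
  define g where "g = (\<lambda>(k, a). k @ [(a, \<Phi> a (zs ! t))])"
  have hist: "history_pmf \<Phi> \<pi> zs (Suc t) = map_pmf g (bind_pmf P (\<lambda>k. map_pmf (Pair k) (\<pi> k)))"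
    by (simp add: P_def g_def map_bind_pmf map_pmf_comp)
  have "inj g" by (auto simp: g_def inj_on_def)
  \<comment> \<open>Split on whether \<open>h\<close> can end with a round whose latent is
    \<open>zs ! t\<close>; if it cannot, both sides are \<open>0\<close>.\<close>
  show ?case
  proof (cases "h = [] \<or> snd (last h) \<noteq> \<Phi> (fst (last h)) (zs ! t)")
    case True
    then have "h \<notin> set_pmf (history_pmf \<Phi> \<pi> zs (Suc t))"
      unfolding hist by (auto simp: g_def)
    moreover have "\<not> (length h = Suc t \<and> zs \<in> compatible \<Phi> h)"
    proof
      assume *: "length h = Suc t \<and> zs \<in> compatible \<Phi> h"
      then have "h \<noteq> []" by auto
      moreover from this have "h ! t = last h" using * by (simp add: last_conv_nth)
      ultimately show False using * True by (auto simp: compatible_def)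
    qed
    ultimately show ?thesis by (simp only: if_False pmf_eq_0_set_pmf not_False_eq_True)
  next
    case False
    then have "h = butlast h @ [(fst (last h), \<Phi> (fst (last h)) (zs ! t))]"
      by (metis append_butlast_last_id prod.collapse)
    then obtain k a where h: "h = k @ [(a, \<Phi> a (zs ! t))]" by blast
    then have "pmf (history_pmf \<Phi> \<pi> zs (Suc t)) h =
        pmf (map_pmf g (bind_pmf P (\<lambda>k. map_pmf (Pair k) (\<pi> k)))) (g (k, a))"
      unfolding hist by (simp add: g_def)
    also have "\<dots> = pmf P k * pmf (\<pi> k) a"
      by (simp only: pmf_map_inj'[OF \<open>inj g\<close>] pmf_bind_Pair)
    also have "\<dots> = (if length h = Suc t \<and> zs \<in> compatible \<Phi> h
        then \<Prod>i<Suc t. pmf (\<pi> (take i h)) (fst (h ! i)) else 0)"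
    proof -
      have "(\<Prod>i<t. pmf (\<pi> (take i k)) (fst (k ! i))) = (\<Prod>i<t. pmf (\<pi> (take i h)) (fst (h ! i)))"
        if "length k = t"
        using that by (intro prod.cong) (auto simp: h nth_append)
      then show ?thesis
        unfolding P_def Suc.IH by (simp add: h compatible_snoc nth_append)
    qed
    finally show ?thesis .
  qed
qed

lemma finite_set_history_pmf:
  assumes "\<And>h. finite (set_pmf (\<pi> h))"
  shows "finite (set_pmf (history_pmf \<Phi> \<pi> zs t))"
  using assms by (induction t) auto

section \<open>Joint law of the latents and the history\<close>

definition joint_pmf ::
  "('a \<Rightarrow> 'z \<Rightarrow> 's) \<Rightarrow> ('a, 's) policy \<Rightarrow> 'z list pmf \<Rightarrow> nat \<Rightarrow> ('z list \<times> ('a \<times> 's) list) pmf" where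
  "joint_pmf \<Phi> \<pi> \<mu> t = bind_pmf \<mu> (\<lambda>zs. map_pmf (Pair zs) (history_pmf \<Phi> \<pi> zs t))"

lemma joint_pmf_Suc:
  "joint_pmf \<Phi> \<pi> \<mu> (Suc t) = bind_pmf (joint_pmf \<Phi> \<pi> \<mu> t)
    (\<lambda>(zs, h). map_pmf (\<lambda>a. (zs, h @ [(a, \<Phi> a (zs ! t))])) (\<pi> h))"
  by (simp add: joint_pmf_def bind_assoc_pmf map_bind_pmf bind_map_pmf map_pmf_comp)

lemma finite_set_joint_pmf:
  assumes "finite (set_pmf \<mu>)" "\<And>h. finite (set_pmf (\<pi> h))"
  shows "finite (set_pmf (joint_pmf \<Phi> \<pi> \<mu> t))"
  using assms by (auto simp: joint_pmf_def finite_set_history_pmf)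

lemma set_joint_pmfD:
  assumes "(zs, h) \<in> set_pmf (joint_pmf \<Phi> \<pi> \<mu> t)"
  shows "zs \<in> set_pmf \<mu>" "length h = t" "zs \<in> compatible \<Phi> h"
proof -
  have "zs \<in> set_pmf \<mu> \<and> h \<in> set_pmf (history_pmf \<Phi> \<pi> zs t)"
    using assms by (auto simp: joint_pmf_def)
  then show "zs \<in> set_pmf \<mu>" "length h = t" "zs \<in> compatible \<Phi> h"
    by (auto simp: set_pmf_iff pmf_history_pmf split: if_splits)
qed

text \<open>The policy does not enter, since its action probabilities cancel in Bayes' rule.
  \<open>cond_pmf\<close> is meaningful only when some latent sequence of positive mass is
  compatible with \<open>h\<close>, whence the recurring nonemptiness condition.\<close>

definition posterior :: "('a \<Rightarrow> 'z \<Rightarrow> 's) \<Rightarrow> 'z list pmf \<Rightarrow> ('a \<times> 's) list \<Rightarrow> 'z list pmf" where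
  "posterior \<Phi> \<mu> h = cond_pmf \<mu> (compatible \<Phi> h)"

text \<open>Bayes' rule: the mass of \<open>(zs', h)\<close> is the prior mass times a factor
  \<open>Q\<close> of action probabilities common to all compatible latents, and \<open>Q\<close>
  cancels in the normalisation.\<close>

lemma cond_joint_pmf:
  fixes \<Phi> :: "'a \<Rightarrow> 'z \<Rightarrow> 's"
  assumes "(zs, h) \<in> set_pmf (joint_pmf \<Phi> \<pi> \<mu> t)"
  shows "cond_pmf (joint_pmf \<Phi> \<pi> \<mu> t) {w. snd w = h} = map_pmf (\<lambda>zs. (zs, h)) (posterior \<Phi> \<mu> h)"
proof (rule pmf_eqI)
  fix w :: "'z list \<times> ('a \<times> 's) list"
  define J where "J = joint_pmf \<Phi> \<pi> \<mu> t"
  define Q where "Q = (\<Prod>i<t. pmf (\<pi> (take i h)) (fst (h ! i)))"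
  obtain zs' h' where w: "w = (zs', h')" by force
  note zs = set_joint_pmfD[OF assms]
  have neJ: "set_pmf J \<inter> {w. snd w = h} \<noteq> {}" using assms unfolding J_def by auto
  have ne: "set_pmf \<mu> \<inter> compatible \<Phi> h \<noteq> {}" using zs by blast
  have hist: "pmf (history_pmf \<Phi> \<pi> zs' t) h = indicator (compatible \<Phi> h) zs' * Q" for zs'
    using zs(2) by (simp add: pmf_history_pmf Q_def)
  have pJ: "pmf J (zs', h) = pmf \<mu> zs' * (indicator (compatible \<Phi> h) zs' * Q)" for zs'
    by (simp add: J_def joint_pmf_def pmf_bind_Pair hist)
  \<comment> \<open>\<open>Q\<close> is to be divided out. It is nonzero because it is a factor of
    the positive mass of the given pair.\<close>
  have "pmf J (zs, h) \<noteq> 0" using assms by (simp add: J_def set_pmf_iff)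
  then have "Q \<noteq> 0" by (auto simp: pJ)
  have "measure_pmf.prob J {w. snd w = h} = pmf (map_pmf snd J) h"
    by (simp add: pmf_map vimage_def)
  also have "map_pmf snd J = bind_pmf \<mu> (\<lambda>zs. history_pmf \<Phi> \<pi> zs t)"
    by (simp add: J_def joint_pmf_def map_bind_pmf map_pmf_comp)
  also have "pmf \<dots> h = measure_pmf.prob \<mu> (compatible \<Phi> h) * Q"
    by (simp add: pmf_bind hist)
  finally have mJ: "measure_pmf.prob J {w. snd w = h} = measure_pmf.prob \<mu> (compatible \<Phi> h) * Q" .
  show "pmf (cond_pmf (joint_pmf \<Phi> \<pi> \<mu> t) {w. snd w = h}) w =
      pmf (map_pmf (\<lambda>zs. (zs, h)) (posterior \<Phi> \<mu> h)) w"
  proof (cases "h' = h")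
    case True
    have "pmf (map_pmf (\<lambda>zs. (zs, h)) (posterior \<Phi> \<mu> h)) (zs', h) = pmf (posterior \<Phi> \<mu> h) zs'"
      by (rule pmf_map_inj') (auto simp: inj_on_def)
    then show ?thesis
      using True w \<open>Q \<noteq> 0\<close>
      by (simp add: posterior_def pmf_cond[OF ne] pmf_cond[OF neJ] pJ mJ flip: J_def)
  next
    case False
    then have "w \<notin> set_pmf (map_pmf (\<lambda>zs. (zs, h)) (posterior \<Phi> \<mu> h))" using w by auto
    then show ?thesis using False w by (simp add: pmf_cond[OF neJ] pmf_eq_0_set_pmf flip: J_def)
  qed
qed

lemma finite_set_posterior:
  assumes "finite (set_pmf \<mu>)" "set_pmf \<mu> \<inter> compatible \<Phi> h \<noteq> {}"
  shows "finite (set_pmf (posterior \<Phi> \<mu> h))"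
  using assms by (simp add: posterior_def set_cond_pmf)

text \<open>Disintegration along the history: the latents may be redrawn from the posterior without
  changing the expectation. This carries bounds that hold per history over to the joint law.\<close>

lemma expectation_joint_pmf_posterior:
  fixes G :: "'z list \<times> ('a \<times> 's) list \<Rightarrow> 'v::{banach, second_countable_topology}"
  assumes fin: "finite (set_pmf \<mu>)" "\<And>h. finite (set_pmf (\<pi> h))"
  shows "measure_pmf.expectation (joint_pmf \<Phi> \<pi> \<mu> t) G =
    measure_pmf.expectation (joint_pmf \<Phi> \<pi> \<mu> t)
      (\<lambda>(zs, h). measure_pmf.expectation (posterior \<Phi> \<mu> h) (\<lambda>zs'. G (zs', h)))"
proof -
  define J where "J = joint_pmf \<Phi> \<pi> \<mu> t"
  have finJ: "finite (set_pmf J)" unfolding J_def by (rule finite_set_joint_pmf[OF fin])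
  have ne: "set_pmf J \<inter> {w'. snd w' = snd w} \<noteq> {}" if "w \<in> set_pmf J" for w using that by blast
  have "measure_pmf.expectation J G =
      measure_pmf.expectation (bind_pmf J (\<lambda>w. cond_pmf J {w'. snd w' = snd w})) G"
    by (simp only: bind_cond_pmf_fibre)
  also have "\<dots> = measure_pmf.expectation J
      (\<lambda>w. measure_pmf.expectation (cond_pmf J {w'. snd w' = snd w}) G)"
    using finJ ne by (subst expectation_bind_finite_pmf) (auto simp: set_cond_pmf)
  also have "\<dots> = measure_pmf.expectation J
      (\<lambda>(zs, h). measure_pmf.expectation (posterior \<Phi> \<mu> h) (\<lambda>zs'. G (zs', h)))"
    by (rule expectation_cong_pmf) (auto simp: J_def cond_joint_pmf)
  finally show ?thesis unfolding J_def .
qed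

lemma expectation_joint_pmf_Suc:
  fixes G :: "'z list \<times> ('a \<times> 's) list \<Rightarrow> 'v::{banach, second_countable_topology}"
  assumes fin: "finite (set_pmf \<mu>)" "\<And>h. finite (set_pmf (\<pi> h))"
  shows "measure_pmf.expectation (joint_pmf \<Phi> \<pi> \<mu> (Suc t)) G =
    measure_pmf.expectation (joint_pmf \<Phi> \<pi> \<mu> t)
      (\<lambda>(zs, h). measure_pmf.expectation (\<pi> h) (\<lambda>a. G (zs, h @ [(a, \<Phi> a (zs ! t))])))"
  unfolding joint_pmf_Suc
  by (subst expectation_bind_finite_pmf)
    (auto simp: finite_set_joint_pmf[OF fin] fin(2) split_beta intro!: expectation_cong_pmf)

lemma expectation_add_finite_pmf:
  fixes f g :: "'x \<Rightarrow> real"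
  assumes "finite (set_pmf M)"
  shows "measure_pmf.expectation M (\<lambda>x. f x + g x) =
    measure_pmf.expectation M f + measure_pmf.expectation M g"
  using assms by (intro Bochner_Integration.integral_add integrable_measure_pmf_finite)

lemma expectation_diff_finite_pmf:
  fixes f g :: "'x \<Rightarrow> real"
  assumes "finite (set_pmf M)"
  shows "measure_pmf.expectation M (\<lambda>x. f x - g x) =
    measure_pmf.expectation M f - measure_pmf.expectation M g"
  using assms by (intro Bochner_Integration.integral_diff integrable_measure_pmf_finite)

text \<open>A potential argument with potential \<open>V\<close>: the one-round bound is known only
  under the posterior of each history, so it is averaged over the histories, where the increments of
  \<open>V\<close> telescope.\<close>

lemma expectation_joint_pmf_telescope:
  fixes \<Phi> :: "'a \<Rightarrow> 'z \<Rightarrow> 's" and G :: "'z list \<Rightarrow> nat \<Rightarrow> 'a \<Rightarrow> real" and V :: "('a \<times> 's) list \<Rightarrow> real"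
  assumes fin: "finite (set_pmf \<mu>)" "\<And>h. finite (set_pmf (\<pi> h))"
    and step: "\<And>h. length h < n \<Longrightarrow> set_pmf \<mu> \<inter> compatible \<Phi> h \<noteq> {} \<Longrightarrow>
      measure_pmf.expectation (posterior \<Phi> \<mu> h)
        (\<lambda>zs. measure_pmf.expectation (\<pi> h) (G zs (length h))) \<le>
      \<kappa> + \<gamma> * (measure_pmf.expectation (posterior \<Phi> \<mu> h) (\<lambda>zs.
        measure_pmf.expectation (\<pi> h) (\<lambda>a. V (h @ [(a, \<Phi> a (zs ! length h))]))) - V h)"
    and t: "t \<le> n"
  shows "measure_pmf.expectation (joint_pmf \<Phi> \<pi> \<mu> t) (\<lambda>(zs, h). \<Sum>i<t. G zs i (fst (h ! i))) \<le>
    real t * \<kappa> + \<gamma> * (measure_pmf.expectation (joint_pmf \<Phi> \<pi> \<mu> t) (\<lambda>(zs, h). V h) - V [])"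
  using t
proof (induction t)
  case 0
  have "joint_pmf \<Phi> \<pi> \<mu> 0 = map_pmf (\<lambda>zs. (zs, [])) \<mu>"
    by (simp add: joint_pmf_def map_pmf_def bind_return_pmf)
  then show ?case by simp
next
  case (Suc t)
  define J where "J = joint_pmf \<Phi> \<pi> \<mu> t"
  have finJ: "finite (set_pmf J)" unfolding J_def by (rule finite_set_joint_pmf[OF fin])
  define S where "S = (\<lambda>(zs, h :: ('a \<times> 's) list). \<Sum>i<t. G zs i (fst (h ! i)))"
  define g where "g = (\<lambda>(zs, h). measure_pmf.expectation (\<pi> h) (G zs t))"
  define v where "v = (\<lambda>(zs, h). measure_pmf.expectation (\<pi> h) (\<lambda>a. V (h @ [(a, \<Phi> a (zs ! t))])))"
  \<comment> \<open>The history before the last round has length \<open>t\<close>, so the appended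
    entry sits at index \<open>t\<close> and the earlier summands read only the prefix.\<close>
  have split: "measure_pmf.expectation (joint_pmf \<Phi> \<pi> \<mu> (Suc t))
      (\<lambda>(zs, h). \<Sum>i<Suc t. G zs i (fst (h ! i))) =
      measure_pmf.expectation J (\<lambda>w. S w + g w)"
    unfolding expectation_joint_pmf_Suc[OF fin] J_def[symmetric]
  proof (rule expectation_cong_pmf)
    fix w assume "w \<in> set_pmf J"
    moreover obtain zs h where w: "w = (zs, h)" by force
    ultimately have "length h = t" unfolding J_def by (auto dest: set_joint_pmfD)
    then show "(case w of (zs, h) \<Rightarrow> measure_pmf.expectation (\<pi> h) (\<lambda>a.
        case (zs, h @ [(a, \<Phi> a (zs ! t))]) of (zs, h) \<Rightarrow> \<Sum>i<Suc t. G zs i (fst (h ! i)))) = S w + g w"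
      by (simp add: w S_def g_def nth_append expectation_add_finite_pmf fin(2))
  qed
  \<comment> \<open>\<open>step\<close> speaks about posterior averages: the latents are redrawn
    before it is applied, and the opposite exchange below returns to the joint law.\<close>
  have "measure_pmf.expectation J g = measure_pmf.expectation J
      (\<lambda>(zs, h). measure_pmf.expectation (posterior \<Phi> \<mu> h) (\<lambda>zs'. g (zs', h)))"
    unfolding J_def by (rule expectation_joint_pmf_posterior[OF fin])
  also have "\<dots> \<le> measure_pmf.expectation J (\<lambda>(zs, h). \<kappa> + \<gamma> *
      (measure_pmf.expectation (posterior \<Phi> \<mu> h) (\<lambda>zs'. v (zs', h)) - V h))"
  proof (rule expectation_mono_finite_pmf[OF finJ])
    fix w assume "w \<in> set_pmf J"
    moreover obtain zs h where w: "w = (zs, h)" by force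
    ultimately have "length h = t" "zs \<in> set_pmf \<mu> \<inter> compatible \<Phi> h"
      unfolding J_def by (auto dest: set_joint_pmfD)
    then show "(case w of (zs, h) \<Rightarrow> measure_pmf.expectation (posterior \<Phi> \<mu> h) (\<lambda>zs'. g (zs', h))) \<le>
        (case w of (zs, h) \<Rightarrow> \<kappa> + \<gamma> *
          (measure_pmf.expectation (posterior \<Phi> \<mu> h) (\<lambda>zs'. v (zs', h)) - V h))"
      using step[of h] Suc.prems unfolding w g_def v_def by fastforce
  qed
  also have "\<dots> = \<kappa> + \<gamma> * (measure_pmf.expectation J (\<lambda>(zs, h).
      measure_pmf.expectation (posterior \<Phi> \<mu> h) (\<lambda>zs'. v (zs', h))) -
      measure_pmf.expectation J (\<lambda>(zs, h). V h))"
    by (simp add: case_prod_unfold expectation_add_finite_pmf[OF finJ]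
        expectation_diff_finite_pmf[OF finJ])
  also have "measure_pmf.expectation J (\<lambda>(zs, h).
      measure_pmf.expectation (posterior \<Phi> \<mu> h) (\<lambda>zs'. v (zs', h))) = measure_pmf.expectation J v"
    unfolding J_def by (rule expectation_joint_pmf_posterior[OF fin, symmetric])
  finally have g: "measure_pmf.expectation J g \<le>
      \<kappa> + \<gamma> * (measure_pmf.expectation J v - measure_pmf.expectation J (\<lambda>(zs, h). V h))" .
  have v: "measure_pmf.expectation (joint_pmf \<Phi> \<pi> \<mu> (Suc t)) (\<lambda>(zs, h). V h) = measure_pmf.expectation J v"
    unfolding expectation_joint_pmf_Suc[OF fin] J_def v_def by simp
  have S: "measure_pmf.expectation J S \<le>
      real t * \<kappa> + \<gamma> * (measure_pmf.expectation J (\<lambda>(zs, h). V h) - V [])"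
    unfolding J_def S_def using Suc by simp
  have "measure_pmf.expectation J (\<lambda>w. S w + g w) \<le>
      real (Suc t) * \<kappa> + \<gamma> * (measure_pmf.expectation J v - V [])"
    using add_mono[OF S g] by (simp add: expectation_add_finite_pmf[OF finJ] algebra_simps)
  then show ?case unfolding split v .
qed

subsection \<open>Regret\<close>

text \<open>The worst-case excess loss is Lipschitz in \<open>b\<close>, hence attains its minimum
  on the compact set \<open>D\<close>; the minimum for this \<open>a\<close> is at most the maximum
  over \<open>A\<close>.\<close>

lemma approx_err_attained:
  fixes A D :: "(real^'d) set" and Z :: "'z set"
  assumes game: "linear_pm_game A S Z \<Phi> loss" and A: "finite A" "a \<in> A"
    and D: "compact D" "D \<noteq> {}" and Z: "Z \<noteq> {}"
  obtains b where "b \<in> D" "\<And>z. z \<in> Z \<Longrightarrow> (b - a) \<bullet> loss z \<le> approx_err A Z D loss"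
proof -
  \<comment> \<open>The coordinates of a loss vector lie in \<open>[0, 1]\<close>, so its Euclidean
    norm is at most its l1 norm, hence at most the dimension.\<close>
  define B where "B = real CARD('d)"
  have B: "norm (loss z) \<le> B" if "z \<in> Z" for z
  proof -
    have "norm (loss z) \<le> (\<Sum>i\<in>UNIV. \<bar>loss z $ i\<bar>)" by (rule norm_le_l1_cart)
    also have "\<dots> \<le> (\<Sum>i\<in>(UNIV :: 'd set). 1)"
      using game that by (intro sum_mono) (auto simp: linear_pm_game_def abs_le_iff)
    finally show ?thesis by (simp add: B_def)
  qed
  have le: "x \<bullet> loss z \<le> norm x * B" if "z \<in> Z" for x z
    using norm_cauchy_schwarz[of x "loss z"] B[OF that] mult_left_mono[of _ _ "norm x"]
    by (meson norm_ge_zero order_trans)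
  define g where "g b = (SUP z\<in>Z. (b - a) \<bullet> loss z)" for b
  have bdd: "bdd_above ((\<lambda>z. (b - a) \<bullet> loss z) ` Z)" for b
    using le by (auto intro!: bdd_aboveI2)
  have g_le: "g b \<le> g b' + B * dist b b'" for b b'
    unfolding g_def
  proof (rule cSUP_least[OF Z])
    fix z assume z: "z \<in> Z"
    have "(b - a) \<bullet> loss z = (b' - a) \<bullet> loss z + (b - b') \<bullet> loss z"
      by (simp add: inner_diff_left)
    also have "(b' - a) \<bullet> loss z \<le> (SUP z\<in>Z. (b' - a) \<bullet> loss z)"
      by (rule cSUP_upper[OF z bdd])
    also have "(b - b') \<bullet> loss z \<le> B * dist b b'"
      using le[OF z, of "b - b'"] by (simp add: dist_norm mult.commute)
    finally show "(b - a) \<bullet> loss z \<le> (SUP z\<in>Z. (b' - a) \<bullet> loss z) + B * dist b b'" by simp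
  qed
  have "B-lipschitz_on D g"
  proof (rule lipschitz_onI)
    fix x y
    show "dist (g x) (g y) \<le> B * dist x y"
      using g_le[of x y] g_le[of y x] by (simp add: dist_real_def abs_le_iff dist_commute)
  qed (simp add: B_def)
  then have "continuous_on D g" by (rule lipschitz_on_continuous_on)
  then obtain b where b: "b \<in> D" "\<And>y. y \<in> D \<Longrightarrow> g b \<le> g y"
    using continuous_attains_inf[OF D] by blast
  have "g b \<le> (INF b\<in>D. g b)" using b D by (intro cINF_greatest) auto
  also have "\<dots> \<le> approx_err A Z D loss"
    unfolding approx_err_def g_def using A by (intro Max_ge) auto
  finally have "(b - a) \<bullet> loss z \<le> approx_err A Z D loss" if "z \<in> Z" for z
    using cSUP_upper[OF that bdd[of b]] unfolding g_def by linarith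
  with b(1) that show ?thesis by blast
qed

text \<open>Identifies the conditional mean in the information ratio with the next posterior mean,
  so that the divergence there compares consecutive posterior means. Given the action, seeing the
  signal adds one compatibility constraint on the latents.\<close>

lemma cond_expect_latent_signal:
  fixes \<Phi> :: "'a \<Rightarrow> 'z \<Rightarrow> 's" and b :: "'z list \<Rightarrow> 'v::{banach, second_countable_topology}"
  assumes zs: "zs \<in> set_pmf (posterior \<Phi> \<mu> h)" and ne: "set_pmf \<mu> \<inter> compatible \<Phi> h \<noteq> {}"
    and a: "a \<in> set_pmf p"
  shows "cond_expect (pair_pmf (map_pmf (\<lambda>zs. (zs ! length h, b zs)) (posterior \<Phi> \<mu> h)) p)
      (\<lambda>((z, y), a). (\<Phi> a z, a)) (\<lambda>((z, y), a). y) ((zs ! length h, b zs), a) =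
    measure_pmf.expectation (posterior \<Phi> \<mu> (h @ [(a, \<Phi> a (zs ! length h))])) b"
proof -
  define g where "g zs = (zs ! length h, b zs)" for zs
  define \<sigma> where "\<sigma> = \<Phi> a (zs ! length h)"
  define V where "V = {w :: 'z \<times> 'v. \<Phi> a (fst w) = \<sigma>}"
  have zs': "zs \<in> set_pmf \<mu> \<inter> (compatible \<Phi> h \<inter> {zs. \<Phi> a (zs ! length h) = \<sigma>})"
    using zs ne by (auto simp: posterior_def \<sigma>_def)
  have V: "set_pmf (map_pmf g (posterior \<Phi> \<mu> h)) \<inter> V \<noteq> {}" "set_pmf (posterior \<Phi> \<mu> h) \<inter> g -` V \<noteq> {}"
    using zs by (auto simp: g_def V_def \<sigma>_def)
  have gV: "g -` V = {zs. \<Phi> a (zs ! length h) = \<sigma>}" by (auto simp: g_def V_def)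
  define sig where "sig = (\<lambda>((z, y :: 'v), a). (\<Phi> a z, a))"
  \<comment> \<open>Fixing signal and action cuts out a rectangle: once the action is
    \<open>a\<close>, the latent alone decides the signal.\<close>
  have "{w'. sig w' = sig (g zs, a)} = V \<times> {a}"
    by (auto simp: sig_def g_def V_def \<sigma>_def)
  then have "cond_expect (pair_pmf (map_pmf g (posterior \<Phi> \<mu> h)) p) sig (\<lambda>((z, y), a). y) (g zs, a) =
    measure_pmf.expectation (cond_pmf (pair_pmf (map_pmf g (posterior \<Phi> \<mu> h)) p) (V \<times> {a})) (\<lambda>((z, y), a). y)"
    unfolding cond_expect_def by simp
  also have "\<dots> = measure_pmf.expectation (cond_pmf (posterior \<Phi> \<mu> h) (g -` V)) b"
    using V by (simp add: cond_pair_pmf_Times_singleton a cond_map_pmf) (simp add: g_def)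
  also have "cond_pmf (posterior \<Phi> \<mu> h) (g -` V) = posterior \<Phi> \<mu> (h @ [(a, \<sigma>)])"
    unfolding gV posterior_def compatible_snoc using zs' by (intro cond_cond_pmf) blast
  finally show ?thesis unfolding g_def \<sigma>_def sig_def .
qed

section \<open>One-round regret and the choice of the tangent point\<close>

lemma rpow_nonneg: "0 \<le> rpow x s"
  by (simp add: rpow_def)

text \<open>The posterior mean of \<open>b\<close> is a martingale with next value \<open>X\<close>,
  so the expected divergence is at most the expected increment of \<open>V\<close>. The tangent at
  \<open>m\<close> then makes the bound affine in that increment.\<close>

lemma information_ratio_step:
  fixes \<Phi> :: "real^'d \<Rightarrow> 'z \<Rightarrow> 's" and \<mu> :: "'z list pmf" and D :: "(real^'d) set"
    and b :: "'z list \<Rightarrow> real^'d" and F :: "real^'d \<Rightarrow> ereal"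
  defines "V \<equiv> \<lambda>h. real_of_ereal (F (measure_pmf.expectation (posterior \<Phi> \<mu> h) b))"
  assumes F: "proper F" "econvex F" and D: "convex D" "D \<subseteq> edom F"
    and b: "\<And>zs. b zs \<in> D" and \<mu>: "finite (set_pmf \<mu>)"
    and ne: "set_pmf \<mu> \<inter> compatible \<Phi> h \<noteq> {}" and p: "finite (set_pmf p)"
    and lam: "1 \<le> lam" and s: "s = 1 / lam" and m: "0 < m"
    and \<nu>: "\<nu> = map_pmf (\<lambda>zs. (zs ! length h, b zs)) (posterior \<Phi> \<mu> h)"
    and ratio: "ereal (measure_pmf.expectation (pair_pmf \<nu> p) (\<lambda>((z, b), a). (a - b) \<bullet> loss z)) \<le>
         ereal \<alpha> + ereal (rpow \<beta> (1 - 1 / lam)) *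
           epow (eexpectation (pair_pmf \<nu> p)
             (\<lambda>w. bregman F
                (cond_expect (pair_pmf \<nu> p) (\<lambda>((z, b), a). (\<Phi> a z, a)) (\<lambda>((z, b), a). b) w)
                (measure_pmf.expectation (pair_pmf \<nu> p) (\<lambda>((z, b), a). b))))
             (1 / lam)"
  shows "measure_pmf.expectation (posterior \<Phi> \<mu> h)
      (\<lambda>zs. measure_pmf.expectation p (\<lambda>a. (a - b zs) \<bullet> loss (zs ! length h))) \<le>
    \<alpha> + rpow \<beta> (1 - s) * m powr (s - 1) * (1 - s) * m +
    rpow \<beta> (1 - s) * m powr (s - 1) * s *
      (measure_pmf.expectation (posterior \<Phi> \<mu> h) (\<lambda>zs.
        measure_pmf.expectation p (\<lambda>a. V (h @ [(a, \<Phi> a (zs ! length h))]))) - V h)"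
proof -
  define f where "f x = real_of_ereal (F x)" for x
  define P where "P = posterior \<Phi> \<mu> h"
  define N where "N = pair_pmf \<nu> p"
  define X where "X = cond_expect N (\<lambda>((z, b), a). (\<Phi> a z, a)) (\<lambda>((z, b), a). b)"
  have finP: "finite (set_pmf P)" unfolding P_def by (rule finite_set_posterior[OF \<mu> ne])
  then have finN: "finite (set_pmf N)" using p by (simp add: N_def \<nu> P_def)
  have EN: "measure_pmf.expectation N g = measure_pmf.expectation P
      (\<lambda>zs. measure_pmf.expectation p (\<lambda>a. g ((zs ! length h, b zs), a)))"
    for g :: "_ \<Rightarrow> 'v::{banach, second_countable_topology}"
    using finP p by (simp add: N_def \<nu> P_def expectation_pair_finite_pmf)
  have X: "X ((zs ! length h, b zs), a) =
      measure_pmf.expectation (posterior \<Phi> \<mu> (h @ [(a, \<Phi> a (zs ! length h))])) b"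
    if "zs \<in> set_pmf P" "a \<in> set_pmf p" for zs a
    unfolding X_def N_def \<nu> using that ne by (intro cond_expect_latent_signal) (auto simp: P_def)
  have XD: "X w \<in> D" if "w \<in> set_pmf N" for w
    unfolding X_def using finN D(1) _ that
    by (rule cond_expect_in_convex) (auto simp: N_def \<nu> b)
  define q where "q = measure_pmf.expectation N (\<lambda>((z, b), a). b)"
  \<comment> \<open>The tower property presents \<open>q\<close> as the mean of \<open>X\<close>, as
    the divergence bound requires.\<close>
  have "q = measure_pmf.expectation N X"
    unfolding q_def X_def by (rule expectation_cond_expect[OF finN, symmetric])
  then obtain w where w: "eexpectation N (\<lambda>x. bregman F (X x) q) = ereal w" "0 \<le> w"
    "w \<le> measure_pmf.expectation N (\<lambda>x. f (X x)) - f q"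
    using eexpectation_bregman_mean[OF F D finN, of X q] XD unfolding f_def by blast
  have "q = measure_pmf.expectation P b" unfolding q_def by (simp add: EN)
  then have fq: "f q = V h" by (simp add: V_def f_def P_def)
  have "measure_pmf.expectation N (\<lambda>x. f (X x)) = measure_pmf.expectation P
      (\<lambda>zs. measure_pmf.expectation p (\<lambda>a. V (h @ [(a, \<Phi> a (zs ! length h))])))"
    unfolding EN by (intro expectation_cong_pmf) (simp add: X V_def f_def)
  note w(3)[unfolded this fq]
  define K where "K = rpow \<beta> (1 - s)"
  \<comment> \<open>The expected increment of \<open>V\<close> dominates the divergence
    \<open>w\<close> and is the quantity that will telescope.\<close>
  define \<Delta> where "\<Delta> = measure_pmf.expectation P
      (\<lambda>zs. measure_pmf.expectation p (\<lambda>a. V (h @ [(a, \<Phi> a (zs ! length h))]))) - V h"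
  have w\<Delta>: "w \<le> \<Delta>" unfolding \<Delta>_def by fact
  have s01: "0 < s" "s \<le> 1" using lam s by auto
  have "w powr s \<le> m powr (s - 1) * (s * w + (1 - s) * m)"
    by (rule powr_le_tangent) (use s01 m w(2) in auto)
  also have "\<dots> \<le> m powr (s - 1) * (s * \<Delta> + (1 - s) * m)"
    using s01 w\<Delta> by (intro mult_left_mono add_right_mono) auto
  finally have tangent: "w powr s \<le> m powr (s - 1) * (s * \<Delta> + (1 - s) * m)" .
  have "measure_pmf.expectation P (\<lambda>zs. measure_pmf.expectation p
        (\<lambda>a. (a - b zs) \<bullet> loss (zs ! length h))) =
      measure_pmf.expectation N (\<lambda>((z, b), a). (a - b) \<bullet> loss z)"
    by (simp add: EN)
  \<comment> \<open>The expected divergence is the real number \<open>w\<close>, so the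
    extended-real ratio inequality becomes one between reals.\<close>
  also have "\<dots> \<le> \<alpha> + K * w powr s"
    using ratio unfolding N_def[symmetric] X_def[symmetric] q_def[symmetric] w(1)
    by (simp add: epow_def s K_def)
  also have "\<dots> \<le> \<alpha> + K * (m powr (s - 1) * (s * \<Delta> + (1 - s) * m))"
    using tangent by (intro add_left_mono mult_left_mono) (auto simp: K_def rpow_nonneg)
  also have "\<dots> = \<alpha> + K * m powr (s - 1) * (1 - s) * m + K * m powr (s - 1) * s * \<Delta>"
    by (simp add: algebra_simps)
  finally show ?thesis unfolding P_def K_def \<Delta>_def .
qed

text \<open>
  The best choice is \<open>m = \<delta> / n\<close>; it is unavailable for \<open>\<delta> = 0\<close>, where \<open>m\<close> tends to \<open>0\<close> instead.
\<close>

lemma optimise_tangent_point: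
  fixes \<delta> \<beta> lam R c :: real
  assumes n: "1 \<le> n" and \<beta>: "0 \<le> \<beta>" and \<delta>: "0 \<le> \<delta>" and lam: "1 \<le> lam" and s: "s = 1 / lam"
    and R: "\<And>m. 0 < m \<Longrightarrow> R \<le> c + rpow \<beta> (1 - s) * m powr (s - 1) * (real n * (1 - s) * m + s * \<delta>)"
  shows "R \<le> c + rpow (\<beta> * real n) (1 - s) * rpow \<delta> s"
proof (cases "\<delta> = 0")
  case False
  have s01: "0 < s" "s \<le> 1" using lam s by auto
  have "R \<le> c + rpow \<beta> (1 - s) * (\<delta> / n) powr (s - 1) * (real n * (1 - s) * (\<delta> / n) + s * \<delta>)"
    using False \<delta> n by (intro R) auto
  also have "real n * (1 - s) * (\<delta> / n) + s * \<delta> = \<delta>"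
    using n by (simp add: field_simps)
  also have "(\<delta> / n) powr (s - 1) = \<delta> powr s / \<delta> * (real n powr (1 - s))"
    using n \<delta> False by (simp add: powr_divide powr_diff)
  also have "rpow \<beta> (1 - s) * (\<delta> powr s / \<delta> * real n powr (1 - s)) * \<delta> =
      (rpow \<beta> (1 - s) * real n powr (1 - s)) * \<delta> powr s"
    using False by simp
  \<comment> \<open>For \<open>s = 1\<close> both sides are \<open>1\<close>: \<open>rpow\<close> is
    \<open>1\<close> at exponent zero, and \<open>n\<close> is positive.\<close>
  also have "rpow \<beta> (1 - s) * real n powr (1 - s) = rpow (\<beta> * real n) (1 - s)"
    using n \<beta> by (simp add: rpow_def powr_mult)
  finally show ?thesis using s01 by (simp add: rpow_def)
next
  case True
  have s01: "0 < s" "s \<le> 1" using lam s by auto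
  define K where "K = rpow \<beta> (1 - s) * real n"
  have K: "0 \<le> K" by (simp add: K_def rpow_nonneg)
  have "R \<le> c + e" if e: "0 < e" for e
  proof -
    \<comment> \<open>Chosen so that \<open>m powr s = e / (K + 1)\<close>, which keeps the
      remaining error \<open>(1 - s) * K * m powr s\<close> at most \<open>e\<close>; the
      \<open>+ 1\<close> guards against \<open>K = 0\<close>.\<close>
    define m where "m = (e / (K + 1)) powr lam"
    have m: "0 < m" using e K by (simp add: m_def)
    have "m powr s = e / (K + 1)"
      using e K lam by (simp add: m_def s powr_powr)
    then have "m powr (s - 1) * m = e / (K + 1)" using m by (simp add: powr_diff)
    have "rpow \<beta> (1 - s) * m powr (s - 1) * (real n * (1 - s) * m + s * \<delta>) =
        (1 - s) * (K * (m powr (s - 1) * m))"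
      by (simp add: True K_def)
    also have "\<dots> = (1 - s) * (K * (e / (K + 1)))"
      using \<open>m powr (s - 1) * m = e / (K + 1)\<close> by simp
    also have "\<dots> \<le> 1 * (K * (e / (K + 1)))"
      using s01 K e by (intro mult_right_mono) auto
    also have "\<dots> \<le> e" using K e by (simp add: field_simps)
    finally show ?thesis using R[OF m] by linarith
  qed
  then have "R \<le> c" by (rule field_le_epsilon)
  then show ?thesis using True s01 by (simp add: rpow_def)
qed

text \<open>No action beats \<open>best zs\<close> in hindsight, and \<open>b zs\<close> exceeds its
  loss by at most \<open>\<epsilon>\<close> per round. Comparison with \<open>b zs\<close> thus
  costs \<open>n * \<epsilon>\<close> uniformly in \<open>a\<close>, which removes the maximum
  before averaging over \<open>\<mu>\<close>.\<close>

lemma bayesian_regret_le: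
  fixes A :: "(real^'d) set" and \<Phi> :: "real^'d \<Rightarrow> 'z \<Rightarrow> 's"
  assumes A: "finite A" "A \<noteq> {}"
    and \<mu>: "finite (set_pmf \<mu>)" "\<And>zs. zs \<in> set_pmf \<mu> \<Longrightarrow> length zs = n \<and> set zs \<subseteq> Z"
    and \<pi>: "\<And>h. finite (set_pmf (\<pi> h))"
    and best: "\<And>zs a. a \<in> A \<Longrightarrow> (\<Sum>t<length zs. (best zs - a) \<bullet> loss (zs ! t)) \<le> 0"
    and b: "\<And>zs z. z \<in> Z \<Longrightarrow> (b zs - best zs) \<bullet> loss z \<le> \<epsilon>"
  shows "bayesian_regret A \<Phi> loss \<pi> \<mu> \<le> measure_pmf.expectation (joint_pmf \<Phi> \<pi> \<mu> n)
    (\<lambda>(zs, h). \<Sum>t<n. (fst (h ! t) - b zs) \<bullet> loss (zs ! t)) + real n * \<epsilon>"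
proof -
  define S where "S zs = measure_pmf.expectation (history_pmf \<Phi> \<pi> zs n)
    (\<lambda>h. \<Sum>t<n. (fst (h ! t) - b zs) \<bullet> loss (zs ! t))" for zs
  have "regret A \<Phi> loss \<pi> zs \<le> S zs + real n * \<epsilon>" if "zs \<in> set_pmf \<mu>" for zs
    unfolding regret_def
  proof (rule Max.boundedI)
    have n: "length zs = n" and Z: "\<And>t. t < n \<Longrightarrow> zs ! t \<in> Z" using \<mu>(2)[OF that] by auto
    fix r assume "r \<in> (\<lambda>a. measure_pmf.expectation (history_pmf \<Phi> \<pi> zs (length zs))
        (\<lambda>h. \<Sum>t<length zs. (fst (h ! t) - a) \<bullet> loss (zs ! t))) ` A"
    then obtain a where a: "a \<in> A" and r: "r = measure_pmf.expectation (history_pmf \<Phi> \<pi> zs n)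
        (\<lambda>h. \<Sum>t<n. (fst (h ! t) - a) \<bullet> loss (zs ! t))" by (auto simp: n)
    have "(\<Sum>t<n. (b zs - best zs) \<bullet> loss (zs ! t)) \<le> (\<Sum>t<n. \<epsilon>)"
      using b Z by (intro sum_mono) auto
    then have "(\<Sum>t<n. (b zs - best zs) \<bullet> loss (zs ! t)) + (\<Sum>t<n. (best zs - a) \<bullet> loss (zs ! t)) \<le> real n * \<epsilon>"
      using best[OF a, of zs] by (simp add: n)
    then have *: "(\<Sum>t<n. (b zs - a) \<bullet> loss (zs ! t)) \<le> real n * \<epsilon>"
      by (simp add: inner_diff_left sum_subtractf)
    have "r \<le> measure_pmf.expectation (history_pmf \<Phi> \<pi> zs n)
        (\<lambda>h. (\<Sum>t<n. (fst (h ! t) - b zs) \<bullet> loss (zs ! t)) + real n * \<epsilon>)"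
      unfolding r
    proof (rule expectation_mono_finite_pmf[OF finite_set_history_pmf[OF \<pi>]])
      fix h :: "((real^'d) \<times> 's) list"
      show "(\<Sum>t<n. (fst (h ! t) - a) \<bullet> loss (zs ! t)) \<le>
          (\<Sum>t<n. (fst (h ! t) - b zs) \<bullet> loss (zs ! t)) + real n * \<epsilon>"
        using * by (simp add: inner_diff_left sum_subtractf)
    qed
    then show "r \<le> S zs + real n * \<epsilon>"
      by (simp add: S_def expectation_add_finite_pmf finite_set_history_pmf[OF \<pi>])
  qed (use A in auto)
  then have "bayesian_regret A \<Phi> loss \<pi> \<mu> \<le> measure_pmf.expectation \<mu> (\<lambda>zs. S zs + real n * \<epsilon>)"
    unfolding bayesian_regret_def by (intro expectation_mono_finite_pmf \<mu>(1)) auto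
  also have "\<dots> = measure_pmf.expectation \<mu> S + real n * \<epsilon>"
    by (simp add: expectation_add_finite_pmf \<mu>(1))
  also have "measure_pmf.expectation \<mu> S = measure_pmf.expectation (joint_pmf \<Phi> \<pi> \<mu> n)
      (\<lambda>(zs, h). \<Sum>t<n. (fst (h ! t) - b zs) \<bullet> loss (zs ! t))"
    unfolding joint_pmf_def S_def
    by (subst expectation_bind_finite_pmf) (auto simp: \<mu>(1) finite_set_history_pmf[OF \<pi>])
  finally show ?thesis .
qed

section \<open>The policy and its regret bound\<close>

theorem theorem5:
  fixes A D :: "(real^'d) set" and S :: "'s set" and Z :: "'z set"
    and \<Phi> :: "real^'d \<Rightarrow> 'z \<Rightarrow> 's" and loss :: "'z \<Rightarrow> real^'d"
    and F :: "real^'d \<Rightarrow> ereal" and \<alpha> \<beta> lam :: real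
    and n :: nat and \<mu> :: "'z list pmf"
  assumes game: "linear_pm_game A S Z \<Phi> loss"
    and leg: "legendre F"
    and D: "D \<subseteq> convex hull A" "compact D" "convex D" "rel_interior D \<noteq> {}"
    and fin: "finite A" "1 < card A"
    and bnd: "\<And>a z. a \<in> A \<Longrightarrow> z \<in> Z \<Longrightarrow> a \<bullet> loss z \<in> {0..1}"
    and dom: "D \<subseteq> edom F"
    and diam: "F_diam F D < \<infinity>"
    and params: "0 \<le> \<alpha>" "0 \<le> \<beta>" "1 \<le> lam"
    and ratio: "has_information_ratio A Z D \<Phi> loss F \<alpha> \<beta> lam"
    and n: "1 \<le> n"
    and \<mu>: "finite (set_pmf \<mu>)" "set_pmf \<mu> \<subseteq> {zs. length zs = n \<and> set zs \<subseteq> Z}"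
  shows "\<exists>\<pi>. is_policy A S \<pi> \<and>
    bayesian_regret A \<Phi> loss \<pi> \<mu> \<le>
      real n * (approx_err A Z D loss + \<alpha>) +
      rpow (\<beta> * real n) (1 - 1 / lam) * rpow (real_of_ereal (F_diam F D)) (1 / lam)"
proof -
  have F: "proper F" "econvex F" using leg by (auto simp: legendre_def)
  have neD: "D \<noteq> {}" using D(4) by auto
  have neA: "A \<noteq> {}" using fin(2) by auto
  then obtain a0 where a0: "a0 \<in> A" by blast
  have lenZ: "length zs = n \<and> set zs \<subseteq> Z" if "zs \<in> set_pmf \<mu>" for zs using that \<mu>(2) by blast
  \<comment> \<open>As \<open>n\<close> is positive, a latent sequence of positive mass has an
    entry, so \<open>Z\<close> is nonempty and suprema over it make sense.\<close>
  obtain zs0 where "zs0 \<in> set_pmf \<mu>" using set_pmf_not_empty[of \<mu>] by blast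
  then have "set zs0 \<subseteq> Z" "set zs0 \<noteq> {}" using lenZ[of zs0] n by auto
  then have neZ: "Z \<noteq> {}" by (metis subset_empty)
  define \<epsilon> where "\<epsilon> = approx_err A Z D loss"
  have "\<exists>a\<in>A. \<forall>a'\<in>A. (\<Sum>t<length zs. (a - a') \<bullet> loss (zs ! t)) \<le> 0" for zs
  proof -
    obtain a where "is_arg_min (\<lambda>a. \<Sum>t<length zs. a \<bullet> loss (zs ! t)) (\<lambda>a. a \<in> A) a"
      using ex_is_arg_min_if_finite[OF fin(1) neA] by blast
    then show ?thesis
      by (intro bexI[of _ a]) (auto simp: is_arg_min_linorder inner_diff_left sum_subtractf)
  qed
  then obtain best where best: "\<And>zs. best zs \<in> A"
    "\<And>zs a. a \<in> A \<Longrightarrow> (\<Sum>t<length zs. (best zs - a) \<bullet> loss (zs ! t)) \<le> 0"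
    by metis
  have "\<exists>b. b \<in> D \<and> (\<forall>z\<in>Z. (b - best zs) \<bullet> loss z \<le> \<epsilon>)" for zs
    using approx_err_attained[OF game fin(1) best(1) D(2) neD neZ] unfolding \<epsilon>_def by metis
  then obtain b where b: "\<And>zs. b zs \<in> D" "\<And>zs z. z \<in> Z \<Longrightarrow> (b zs - best zs) \<bullet> loss z \<le> \<epsilon>"
    by metis
  \<comment> \<open>The law to which the information ratio is applied: the latent of the coming
    round, at index \<open>length h\<close>, jointly with the comparator, under the
    posterior.\<close>
  define \<nu> where "\<nu> h = map_pmf (\<lambda>zs. (zs ! length h, b zs)) (posterior \<Phi> \<mu> h)"
    for h :: "((real^'d) \<times> 's) list"
  define good where "good h p \<longleftrightarrow>
     ereal (measure_pmf.expectation (pair_pmf (\<nu> h) p) (\<lambda>((z, b), a). (a - b) \<bullet> loss z)) \<le>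
         ereal \<alpha> + ereal (rpow \<beta> (1 - 1 / lam)) *
           epow (eexpectation (pair_pmf (\<nu> h) p)
             (\<lambda>w. bregman F
                (cond_expect (pair_pmf (\<nu> h) p) (\<lambda>((z, b), a). (\<Phi> a z, a)) (\<lambda>((z, b), a). b) w)
                (measure_pmf.expectation (pair_pmf (\<nu> h) p) (\<lambda>((z, b), a). b))))
             (1 / lam)" for h p
  \<comment> \<open>Where no round remains or the posterior is meaningless, any action will do;
    \<open>a0\<close> keeps the policy total with values in \<open>A\<close>.\<close>
  have "\<exists>p. set_pmf p \<subseteq> A \<and>
    (length h < n \<and> set_pmf \<mu> \<inter> compatible \<Phi> h \<noteq> {} \<longrightarrow> good h p)" for h
  proof (cases "length h < n \<and> set_pmf \<mu> \<inter> compatible \<Phi> h \<noteq> {}")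
    case True
    then have "set_pmf (posterior \<Phi> \<mu> h) \<subseteq> set_pmf \<mu>" by (simp add: posterior_def)
    moreover have "zs ! length h \<in> Z" if "zs \<in> set_pmf \<mu>" for zs
      using lenZ[OF that] True by (auto simp: subset_iff)
    ultimately have "finite (set_pmf (\<nu> h)) \<and> set_pmf (\<nu> h) \<subseteq> Z \<times> D"
      using finite_set_posterior[OF \<mu>(1), of \<Phi> h] True b(1) by (auto simp: \<nu>_def)
    then show ?thesis
      using ratio unfolding has_information_ratio_def good_def by blast
  next
    case False
    then show ?thesis using a0 by (intro exI[of _ "return_pmf a0"]) auto
  qed
  then obtain \<pi> where \<pi>: "\<And>h. set_pmf (\<pi> h) \<subseteq> A"
    "\<And>h. length h < n \<Longrightarrow> set_pmf \<mu> \<inter> compatible \<Phi> h \<noteq> {} \<Longrightarrow> good h (\<pi> h)"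
    by metis
  have fin\<pi>: "finite (set_pmf (\<pi> h))" for h using \<pi>(1) fin(1) by (rule finite_subset)
  define s where "s = 1 / lam"
  have s01: "0 < s" "s \<le> 1" using params(3) by (auto simp: s_def)
  define \<delta> where "\<delta> = real_of_ereal (F_diam F D)"
  define V where "V h = real_of_ereal (F (measure_pmf.expectation (posterior \<Phi> \<mu> h) b))" for h
  have diff: "real_of_ereal (F x) - real_of_ereal (F y) \<le> \<delta>" if "x \<in> D" "y \<in> D" for x y
  proof -
    have *: "F x = ereal (real_of_ereal (F x))" "F y = ereal (real_of_ereal (F y))"
      using that dom ereal_real_of_edom[OF F(1)] by blast+
    have "F x - F y \<le> F_diam F D"
      unfolding F_diam_def by (rule SUP_upper2[of "(x, y)"]) (use that in auto)
    then have "ereal (real_of_ereal (F x) - real_of_ereal (F y)) \<le> F_diam F D"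
      by (subst (asm) *(1), subst (asm) *(2)) simp
    \<comment> \<open>The diameter is a real number: \<open>diam\<close> bounds it from above, the
      real difference from below.\<close>
    then show ?thesis using diam by (cases "F_diam F D") (auto simp: \<delta>_def)
  qed
  then have \<delta>0: "0 \<le> \<delta>" using neD by force
  define J where "J = joint_pmf \<Phi> \<pi> \<mu> n"
  have finJ: "finite (set_pmf J)" unfolding J_def by (rule finite_set_joint_pmf[OF \<mu>(1) fin\<pi>])
  define R where "R = measure_pmf.expectation J (\<lambda>(zs, h). \<Sum>t<n. (fst (h ! t) - b zs) \<bullet> loss (zs ! t))"
  have post_D: "measure_pmf.expectation (posterior \<Phi> \<mu> h) b \<in> D"
    if "set_pmf \<mu> \<inter> compatible \<Phi> h \<noteq> {}" for h
    using finite_set_posterior[OF \<mu>(1) that] D(3) b(1) by (rule expectation_in_convex)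
  \<comment> \<open>\<open>V h\<close> and \<open>V []\<close> are values of \<open>F\<close> at
    posterior means, which lie in \<open>D\<close>, so the telescoped sum is at most the
    diameter.\<close>
  have "measure_pmf.expectation J (\<lambda>(zs, h). V h) \<le> measure_pmf.expectation J (\<lambda>_. \<delta> + V [])"
  proof (rule expectation_mono_finite_pmf[OF finJ])
    fix w assume "w \<in> set_pmf J"
    moreover obtain zs h where w: "w = (zs, h)" by force
    ultimately have "set_pmf \<mu> \<inter> compatible \<Phi> h \<noteq> {}"
      unfolding J_def by (auto dest: set_joint_pmfD)
    then have "V h - V [] \<le> \<delta>"
      unfolding V_def by (intro diff post_D) (auto simp: set_pmf_not_empty)
    then show "(case w of (zs, h) \<Rightarrow> V h) \<le> \<delta> + V []" by (simp add: w)
  qed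
  then have VJ: "measure_pmf.expectation J (\<lambda>(zs, h). V h) - V [] \<le> \<delta>" by simp
  \<comment> \<open>The policy was fixed without reference to \<open>m\<close>, so the same
    \<open>R\<close> obeys the bound for every \<open>m\<close>, which may be optimised
    afterwards.\<close>
  have "R \<le> real n * \<alpha> + rpow \<beta> (1 - s) * m powr (s - 1) * (real n * (1 - s) * m + s * \<delta>)"
    if m: "0 < m" for m
  proof -
    define k where "k = rpow \<beta> (1 - s) * m powr (s - 1)"
    have k: "0 \<le> k" by (simp add: k_def rpow_nonneg)
    have "R \<le> real n * (\<alpha> + k * (1 - s) * m) + k * s * (measure_pmf.expectation J (\<lambda>(zs, h). V h) - V [])"
      unfolding R_def J_def
    proof (rule expectation_joint_pmf_telescope[where n = n
          and G = "\<lambda>zs t a. (a - b zs) \<bullet> loss (zs ! t)", OF \<mu>(1) fin\<pi>])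
      fix h :: "((real^'d) \<times> 's) list"
      assume h: "length h < n" "set_pmf \<mu> \<inter> compatible \<Phi> h \<noteq> {}"
      show "measure_pmf.expectation (posterior \<Phi> \<mu> h)
          (\<lambda>zs. measure_pmf.expectation (\<pi> h) (\<lambda>a. (a - b zs) \<bullet> loss (zs ! length h))) \<le>
        \<alpha> + k * (1 - s) * m + k * s * (measure_pmf.expectation (posterior \<Phi> \<mu> h) (\<lambda>zs.
          measure_pmf.expectation (\<pi> h) (\<lambda>a. V (h @ [(a, \<Phi> a (zs ! length h))]))) - V h)"
        unfolding k_def V_def
        by (rule information_ratio_step[OF F D(3) dom b(1) \<mu>(1) h(2) fin\<pi> params(3) s_def m \<nu>_def])
          (rule \<pi>(2)[OF h, unfolded good_def])
    qed simp
    also have "\<dots> \<le> real n * (\<alpha> + k * (1 - s) * m) + k * s * \<delta>"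
      using k s01 VJ by (intro add_left_mono mult_left_mono) auto
    finally show ?thesis by (simp add: k_def algebra_simps)
  qed
  then have "R \<le> real n * \<alpha> + rpow (\<beta> * real n) (1 - s) * rpow \<delta> s"
    by (rule optimise_tangent_point[OF n params(2) \<delta>0 params(3) s_def])
  moreover have "bayesian_regret A \<Phi> loss \<pi> \<mu> \<le> R + real n * \<epsilon>"
    unfolding R_def J_def
    by (rule bayesian_regret_le[OF fin(1) neA \<mu>(1) lenZ fin\<pi> best(2) b(2)])
  ultimately have "bayesian_regret A \<Phi> loss \<pi> \<mu> \<le>
      real n * (approx_err A Z D loss + \<alpha>) +
      rpow (\<beta> * real n) (1 - 1 / lam) * rpow (real_of_ereal (F_diam F D)) (1 / lam)"
    by (simp add: \<epsilon>_def \<delta>_def s_def algebra_simps)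
  moreover have "is_policy A S \<pi>" using \<pi>(1) by (simp add: is_policy_def)
  ultimately show ?thesis by blast
qed

end
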